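(* Let $(X^{(\varepsilon)})_{\varepsilon\ge 0}$ be an irreducibly perturbed Markov chain on a finite state space $S$, with stationary distribution $\mu_\varepsilon$ for $\varepsilon>0$. Then the quantities $\hat q_\varepsilon$ satisfy the asymptotic detailed balance equation: for all $P_0$-essential classes $E,E'$, $$\mu_\varepsilon(E)\,\hat q_\varepsilon(E,E')\simeq\mu_\varepsilon(E')\,\hat q_\varepsilon(E',E).$$
   Context: Let $S$ be a finite set. For $\varepsilon\ge 0$ let $X^{(\varepsilon)}=(X^{(\varepsilon)}_n)_{n\ge 0}$ be a discrete time Markov chain on $S$ with transition matrix $P_\varepsilon=(p_\varepsilon(x,y))_{x,y\in S}$; $\mathbb P_\varepsilon^x$ is its path measure when started in $x$. The family is a perturbed Markov chain if $\lim_{\varepsilon\to0}p_\varepsilon(x,y)=p_0(x,y)$ for all $x,y\in S$, and an irreducibly perturbed Markov chain if in addition $X^{(\varepsilon)}$ is irreducible for every $\varepsilon>0$. For $\varepsilon>0$, $\mu_\varepsilon$ denotes the unique stationary distribution, and $\mu_\varepsilon(E)=\sum_{x\in E}\mu_\varepsilon(x)$. For $A\subset S$: $\tau_A^+=\inf\{n>0:X_n\in A\}$, $\tau_x^+=\tau_{\{x\}}^+$, $\inf\emptyset=\infty$. The $P_0$-essential classes are the essential (closed) communicating classes of the chain with transition matrix $P_0$; their collection is $\mathcal E$. For $E\in\mathcal E$, $\nu_E$ is the unique (strictly positive) stationary distribution of the irreducible chain on $E$ with transition matrix $(p_0(x,y))_{x,y\in E}$. For $E\neq E'$ in $\mathcal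 E$, $\hat q_\varepsilon(E,E')=\sum_{x\in E}\nu_E(x)^2\,\mathbb P_\varepsilon^x(\tau_{E'}^+<\tau_x^+)$, and $\hat q_\varepsilon(E,E)=1-\sum_{E'\in\mathcal E\setminus\{E\}}\hat q_\varepsilon(E,E')$ (these form a transition matrix on $\mathcal E$ for all sufficiently small $\varepsilon$). Asymptotic equivalence: for nonnegative functions $a_\varepsilon,b_\varepsilon$ of $\varepsilon$ (small $\varepsilon$ being all that matters for $\hat q_\varepsilon(E,E)$), $a_\varepsilon\simeq b_\varepsilon$ means that either both are identically zero, or there is $\varepsilon_0>0$ with $b_\varepsilon>0$ for all $\varepsilon\in(0,\varepsilon_0)$ and $\lim_{\varepsilon\to0}a_\varepsilon/b_\varepsilon=1$. *)

theory Defs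
  imports "HOL-Probability.Probability"
begin

section \<open>Finite Markov chains and their path measures\<close>

text \<open>Transition matrices are real functions of two states; only their entries on the carrier
  \<open>S\<close> matter.\<close>

definition stochastic_matrix :: "'a set \<Rightarrow> ('a \<Rightarrow> 'a \<Rightarrow> real) \<Rightarrow> bool" where
  "stochastic_matrix S P \<longleftrightarrow>
     (\<forall>x\<in>S. \<forall>y\<in>S. 0 \<le> P x y) \<and> (\<forall>x\<in>S. (\<Sum>y\<in>S. P x y) = 1)"

text \<open>The law of the \<open>n\<close>-th coordinate given the preceding ones, in the form required by the
  Ionescu-Tulcea theorem: the point mass at \<open>x\<close> for \<open>n = 0\<close>, and the row \<open>P (\<omega> m)\<close>
  for \<open>n = m + 1\<close>.\<close>

primrec chain_kernel ::
  "'a set \<Rightarrow> ('a \<Rightarrow> 'a \<Rightarrow> real) \<Rightarrow> 'a \<Rightarrow> nat \<Rightarrow> (nat \<Rightarrow> 'a) \<Rightarrow> 'a measure" where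
  "chain_kernel S P x 0 = (\<lambda>\<omega>. return (count_space S) x)"
| "chain_kernel S P x (Suc m) = (\<lambda>\<omega>. point_measure S (\<lambda>y. ennreal (P (\<omega> m) y)))"

text \<open>The measure on \<open>S\<^sup>\<nat>\<close> that the Ionescu-Tulcea theorem attaches to these kernels; \<open>\<omega> n\<close>
  is the state at time \<open>n\<close>.\<close>

definition path_measure :: "'a set \<Rightarrow> ('a \<Rightarrow> 'a \<Rightarrow> real) \<Rightarrow> 'a \<Rightarrow> (nat \<Rightarrow> 'a) measure" where
  "path_measure S P x =
     projective_family.lim UNIV
       (Ionescu_Tulcea.CI (chain_kernel S P x) (\<lambda>_. count_space S)) (\<lambda>_. count_space S)"

lemma Ionescu_Tulcea_chain_kernel:
  assumes "finite S" "stochastic_matrix S P" "x \<in> S"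
  shows "Ionescu_Tulcea (chain_kernel S P x) (\<lambda>_. count_space S)"
proof (rule Ionescu_Tulcea.intro)
  have row: "prob_space (point_measure S (\<lambda>y. ennreal (P z y)))" if "z \<in> S" for z
  proof
    have "(\<Sum>y\<in>S. ennreal (P z y)) = ennreal (\<Sum>y\<in>S. P z y)"
      using assms that by (intro sum_ennreal) (auto simp: stochastic_matrix_def)
    then show "emeasure (point_measure S (\<lambda>y. ennreal (P z y)))
        (space (point_measure S (\<lambda>y. ennreal (P z y)))) = 1"
      using assms that
      by (simp add: space_point_measure emeasure_point_measure_finite stochastic_matrix_def)
  qed
  show "prob_space (chain_kernel S P x i \<omega>)"
    if "\<omega> \<in> space (PiM {0..<i} (\<lambda>_. count_space S))" for i \<omega>
  proof (cases i)
    case 0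
    then show ?thesis using assms by (simp add: prob_space_return)
  next
    case (Suc m)
    then show ?thesis using that by (simp add: row space_PiM PiE_iff)
  qed
  show "chain_kernel S P x i
      \<in> measurable (PiM {0..<i} (\<lambda>_. count_space S)) (subprob_algebra (count_space S))" for i
  proof (cases i)
    case 0
    then show ?thesis
      using assms
      by (auto simp: space_subprob_algebra intro!: measurable_const prob_space_imp_subprob_space
          prob_space_return)
  next
    case (Suc m)
    have "(\<lambda>\<omega>. \<omega> m) \<in> measurable (PiM {0..<i} (\<lambda>_. count_space S)) (count_space S)"
      using Suc by (intro measurable_component_singleton) auto
    moreover have "(\<lambda>z. point_measure S (\<lambda>y. ennreal (P z y)))
        \<in> measurable (count_space S) (subprob_algebra (count_space S))"
      by (auto simp: space_subprob_algebra sets_point_measure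
          intro!: prob_space_imp_subprob_space row)
    ultimately show ?thesis
      unfolding Suc chain_kernel.simps by (rule measurable_compose)
  qed
qed

lemma
  assumes "finite S" "stochastic_matrix S P" "x \<in> S"
  shows space_path_measure: "space (path_measure S P x) = (UNIV \<rightarrow>\<^sub>E S)"
    and sets_path_measure: "sets (path_measure S P x) = sets (PiM UNIV (\<lambda>_. count_space S))"
    and prob_space_path_measure: "prob_space (path_measure S P x)"
    and path_measure_cylinder: "\<lbrakk>\<And>i. i \<le> n \<Longrightarrow> a i \<in> S\<rbrakk> \<Longrightarrow>
      measure (path_measure S P x) {\<omega> \<in> UNIV \<rightarrow>\<^sub>E S. \<forall>i\<le>n. \<omega> i = a i}
        = of_bool (a 0 = x) * (\<Prod>i<n. P (a i) (a (Suc i)))"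
proof -
  let ?M = "\<lambda>_::nat. count_space S"
  interpret Ionescu_Tulcea "chain_kernel S P x" ?M
    by (rule Ionescu_Tulcea_chain_kernel) fact+
  have lim_eq: "path_measure S P x = PF.lim"
    by (simp add: path_measure_def)
  show "space (path_measure S P x) = (UNIV \<rightarrow>\<^sub>E S)"
    by (simp add: lim_eq space_PiM)
  show "sets (path_measure S P x) = sets (PiM UNIV ?M)"
    by (simp add: lim_eq)
  show prob: "prob_space (path_measure S P x)"
  proof -
    have "prob_space (distr PF.lim (PiM {0::nat} ?M) (\<lambda>x. restrict x {0}))"
      by (subst distr_lim) (auto intro: PF.prob_space_P)
    then show ?thesis
      unfolding lim_eq
      by (rule prob_space_distrD[rotated])
         (auto intro!: measurable_restrict measurable_component_singleton
            simp: measurable_cong_sets[OF PF.sets_lim refl])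
  qed
  assume a: "\<And>i. i \<le> n \<Longrightarrow> a i \<in> S"
  have single: "{restrict a {0..<k}} \<in> sets (PiM {0..<k} ?M)" if "k \<le> Suc n" for k
  proof -
    have "{restrict a {0..<k}} = PiE {0..<k} (\<lambda>i. {a i})"
      by (auto simp: PiE_def Pi_def extensional_def restrict_def fun_eq_iff)
    also have "\<dots> \<in> sets (PiM {0..<k} ?M)"
      using that a by (intro sets_PiM_I_finite) auto
    finally show ?thesis .
  qed
  have C_single: "emeasure (C 0 (Suc k) (\<lambda>_. undefined)) {restrict a {0..<Suc k}}
      = ennreal (of_bool (a 0 = x) * (\<Prod>i<k. P (a i) (a (Suc i))))" if "k \<le> n" for k
    using that
  proof (induction k)
    case 0
    have "a 0 \<in> S" using a by simp
    have "(\<lambda>_::nat. undefined)(0 := z) = restrict a {0..<Suc 0} \<longleftrightarrow> z = a 0" for z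
    proof
      assume "(\<lambda>_::nat. undefined)(0 := z) = restrict a {0..<Suc 0}"
      from fun_cong[OF this, of 0] show "z = a 0" by simp
    qed (auto simp: fun_eq_iff)
    then have "(\<lambda>z. (\<lambda>_::nat. undefined)(0 := z)) -` {restrict a {0..<Suc 0}} \<inter> S = {a 0}"
      using \<open>a 0 \<in> S\<close> by (auto simp del: atLeastLessThanSuc)
    moreover have "C 0 (Suc 0) (\<lambda>_. undefined) = eP 0 (\<lambda>_. undefined)"
      using measurable_eP[of 0] by (simp add: bind_return space_PiM)
    moreover have "emeasure (eP 0 (\<lambda>_. undefined)) {restrict a {0..<Suc 0}}
        = emeasure (chain_kernel S P x 0 (\<lambda>_. undefined))
            ((\<lambda>z. (\<lambda>_::nat. undefined)(0 := z)) -` {restrict a {0..<Suc 0}} \<inter> S)"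
      using single[of "Suc 0"] by (subst emeasure_eP) (auto simp: space_PiM)
    ultimately show ?case
      using \<open>a 0 \<in> S\<close>
      by (simp only: chain_kernel.simps) (simp del: C.simps restrict_apply restrict_apply'
          atLeastLessThanSuc add: indicator_def atLeastLessThan_singleton)
  next
    case (Suc k)
    have aS: "a k \<in> S" "a (Suc k) \<in> S" using a Suc.prems by auto
    let ?C = "C 0 (Suc k) (\<lambda>_. undefined)"
    have spC: "space ?C = space (PiM {0..<Suc k} ?M)"
      by (subst space_C) auto
    have "emeasure (C 0 (Suc (Suc k)) (\<lambda>_. undefined)) {restrict a {0..<Suc (Suc k)}}
        = (\<integral>\<^sup>+\<omega>. eP (Suc k) \<omega> {restrict a {0..<Suc (Suc k)}} \<partial>?C)"
      using single[of "Suc (Suc k)"] Suc.prems measurable_eP[of "Suc k"] \<open>x \<in> S\<close>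
      by (subst C.simps(2), subst emeasure_bind[where N="PiM {0..<Suc (Suc k)} ?M"])
         (auto simp: spC space_PiM_empty_iff measurable_cong_sets[OF sets_C refl] simp del: C.simps)
    also have "\<dots> = (\<integral>\<^sup>+\<omega>. ennreal (P (a k) (a (Suc k))) * indicator {restrict a {0..<Suc k}} \<omega> \<partial>?C)"
    proof (rule nn_integral_cong)
      fix \<omega> assume "\<omega> \<in> space ?C"
      then have \<omega>: "\<omega> \<in> space (PiM {0..<Suc k} ?M)" by (simp only: spC)
      have ext: "\<omega> i = undefined" if "i \<ge> Suc k" for i
        using \<omega> that by (auto simp: space_PiM PiE_def extensional_def)
      have "(\<lambda>z. fun_upd \<omega> (Suc k) z) -` {restrict a {0..<Suc (Suc k)}} \<inter> S
          = (if \<omega> = restrict a {0..<Suc k} then {a (Suc k)} else {})" (is "?L = ?R")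
      proof (intro set_eqI iffI)
        fix z assume z: "z \<in> ?L"
        then have eq: "fun_upd \<omega> (Suc k) z = restrict a {0..<Suc (Suc k)}" by auto
        have "z = a (Suc k)" using fun_cong[OF eq, of "Suc k"] by simp
        moreover have "\<omega> i = restrict a {0..<Suc k} i" for i
          using fun_cong[OF eq, of i] ext[of i] by (cases "i < Suc k") auto
        ultimately show "z \<in> ?R" by auto
      next
        fix z assume "z \<in> ?R"
        then show "z \<in> ?L" using aS by (auto simp: fun_eq_iff split: if_splits)
      qed
      moreover have "\<omega> = restrict a {0..<Suc k} \<Longrightarrow> \<omega> k = a k" by simp
      ultimately show "eP (Suc k) \<omega> {restrict a {0..<Suc (Suc k)}}
          = ennreal (P (a k) (a (Suc k))) * indicator {restrict a {0..<Suc k}} \<omega>"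
        using \<omega> single[of "Suc (Suc k)"] Suc.prems aS \<open>finite S\<close>
        by (auto simp: emeasure_eP emeasure_point_measure_finite)
    qed
    also have "\<dots> = ennreal (P (a k) (a (Suc k))) * emeasure ?C {restrict a {0..<Suc k}}"
      using single[of "Suc k"] Suc.prems
      by (intro nn_integral_cmult_indicator) (simp add: sets_C del: C.simps)
    also have "\<dots> = ennreal (P (a k) (a (Suc k)))
        * ennreal (of_bool (a 0 = x) * (\<Prod>i<k. P (a i) (a (Suc i))))"
      using Suc by (simp only: Suc_leD)
    also have "\<dots> = ennreal (of_bool (a 0 = x) * (\<Prod>i<Suc k. P (a i) (a (Suc i))))"
      using aS assms(2) by (subst ennreal_mult'[symmetric]) (auto simp: stochastic_matrix_def ac_simps)
    finally show ?case .
  qed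
  have emb: "PF.emb UNIV {0..<Suc n} {restrict a {0..<Suc n}}
      = {\<omega> \<in> UNIV \<rightarrow>\<^sub>E S. \<forall>i\<le>n. \<omega> i = a i}"
  proof -
    have "restrict \<omega> {0..<Suc n} = restrict a {0..<Suc n} \<longleftrightarrow> (\<forall>i\<le>n. \<omega> i = a i)" for \<omega>
      by (metis (mono_tags, lifting) atLeastLessThan_iff less_Suc_eq_le restrict_apply' restrict_ext zero_le)
    then show ?thesis by (auto simp: prod_emb_def space_PiM simp del: atLeastLessThanSuc)
  qed
  have emb': "PF.emb {0..<Suc n} {0..<Suc n} {restrict a {0..<Suc n}} = {restrict a {0..<Suc n}}"
    using a by (intro prod_emb_id) auto
  have "emeasure (path_measure S P x) {\<omega> \<in> UNIV \<rightarrow>\<^sub>E S. \<forall>i\<le>n. \<omega> i = a i}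
      = ennreal (of_bool (a 0 = x) * (\<Prod>i<n. P (a i) (a (Suc i))))"
    unfolding emb[symmetric] lim_eq
    using C_single[of n] single[of "Suc n"]
    by (simp add: lim emeasure_CI[OF subset_refl] emb' del: C.simps)
  then show "measure (path_measure S P x) {\<omega> \<in> UNIV \<rightarrow>\<^sub>E S. \<forall>i\<le>n. \<omega> i = a i}
      = of_bool (a 0 = x) * (\<Prod>i<n. P (a i) (a (Suc i)))"
    using a assms(2) unfolding measure_def
    by (simp only:)
       (auto intro!: enn2real_ennreal mult_nonneg_nonneg prod_nonneg simp: stochastic_matrix_def)
qed


section \<open>Communicating classes, stationary distributions, return times\<close>

primrec n_step :: "'a set \<Rightarrow> ('a \<Rightarrow> 'a \<Rightarrow> real) \<Rightarrow> nat \<Rightarrow> 'a \<Rightarrow> 'a \<Rightarrow> real" where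
  "n_step S P 0 x y = of_bool (x = y)"
| "n_step S P (Suc n) x y = (\<Sum>z\<in>S. P x z * n_step S P n z y)"

text \<open>The value \<open>n = 0\<close> is allowed, so that every state, transient or not, lies in exactly
  one communicating class.\<close>

definition accessible :: "'a set \<Rightarrow> ('a \<Rightarrow> 'a \<Rightarrow> real) \<Rightarrow> 'a \<Rightarrow> 'a \<Rightarrow> bool" where
  "accessible S P x y \<longleftrightarrow> (\<exists>n. n_step S P n x y > 0)"

definition irreducible_matrix :: "'a set \<Rightarrow> ('a \<Rightarrow> 'a \<Rightarrow> real) \<Rightarrow> bool" where
  "irreducible_matrix S P \<longleftrightarrow> (\<forall>x\<in>S. \<forall>y\<in>S. accessible S P x y)"

definition communicating_classes :: "'a set \<Rightarrow> ('a \<Rightarrow> 'a \<Rightarrow> real) \<Rightarrow> 'a set set" where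
  "communicating_classes S P =
     S // {(x, y). x \<in> S \<and> y \<in> S \<and> accessible S P x y \<and> accessible S P y x}"

definition essential_classes :: "'a set \<Rightarrow> ('a \<Rightarrow> 'a \<Rightarrow> real) \<Rightarrow> 'a set set" where
  "essential_classes S P =
     {E \<in> communicating_classes S P. \<forall>x\<in>E. \<forall>y\<in>S. accessible S P x y \<longrightarrow> y \<in> E}"

text \<open>Used both for the whole state space (\<open>A = S\<close>) and for the chain restricted to an essential
  class (\<open>A = E\<close>).\<close>

definition stationary_distribution :: "'a set \<Rightarrow> ('a \<Rightarrow> 'a \<Rightarrow> real) \<Rightarrow> ('a \<Rightarrow> real) \<Rightarrow> bool" where
  "stationary_distribution A P \<mu> \<longleftrightarrow>
     (\<forall>x\<in>A. 0 \<le> \<mu> x) \<and> (\<Sum>x\<in>A. \<mu> x) = 1 \<and> (\<forall>y\<in>A. (\<Sum>x\<in>A. \<mu> x * P x y) = \<mu> y)"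

text \<open>In \<^typ>\<open>enat\<close> the infimum of the empty set is \<open>\<infinity>\<close>.\<close>

definition return_time :: "'a set \<Rightarrow> (nat \<Rightarrow> 'a) \<Rightarrow> enat" where
  "return_time A \<omega> = Inf (enat ` {n. 0 < n \<and> \<omega> n \<in> A})"


section \<open>Perturbed Markov chains\<close>

definition perturbed_markov_chain :: "'a set \<Rightarrow> (real \<Rightarrow> 'a \<Rightarrow> 'a \<Rightarrow> real) \<Rightarrow> bool" where
  "perturbed_markov_chain S P \<longleftrightarrow>
     finite S \<and> (\<forall>\<epsilon>\<ge>0. stochastic_matrix S (P \<epsilon>)) \<and>
     (\<forall>x\<in>S. \<forall>y\<in>S. ((\<lambda>\<epsilon>. P \<epsilon> x y) \<longlongrightarrow> P 0 x y) (at_right 0))"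

definition irreducibly_perturbed_markov_chain ::
  "'a set \<Rightarrow> (real \<Rightarrow> 'a \<Rightarrow> 'a \<Rightarrow> real) \<Rightarrow> bool" where
  "irreducibly_perturbed_markov_chain S P \<longleftrightarrow>
     perturbed_markov_chain S P \<and> (\<forall>\<epsilon>>0. irreducible_matrix S (P \<epsilon>))"

text \<open>The off-diagonal entries; \<open>\<nu> E\<close> stands for the stationary distribution of the unperturbed
  chain on the essential class \<open>E\<close>.\<close>

definition q_hat_off ::
  "'a set \<Rightarrow> (real \<Rightarrow> 'a \<Rightarrow> 'a \<Rightarrow> real) \<Rightarrow> ('a set \<Rightarrow> 'a \<Rightarrow> real) \<Rightarrow> real \<Rightarrow> 'a set \<Rightarrow> 'a set \<Rightarrow> real"
where
  "q_hat_off S P \<nu> \<epsilon> E E' =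
     (\<Sum>x\<in>E. (\<nu> E x)\<^sup>2 *
        measure (path_measure S (P \<epsilon>) x)
          {\<omega> \<in> space (path_measure S (P \<epsilon>) x). return_time E' \<omega> < return_time {x} \<omega>})"

definition q_hat ::
  "'a set \<Rightarrow> (real \<Rightarrow> 'a \<Rightarrow> 'a \<Rightarrow> real) \<Rightarrow> ('a set \<Rightarrow> 'a \<Rightarrow> real) \<Rightarrow> real \<Rightarrow> 'a set \<Rightarrow> 'a set \<Rightarrow> real"
where
  "q_hat S P \<nu> \<epsilon> E E' =
     (if E = E' then 1 - (\<Sum>E''\<in>essential_classes S (P 0) - {E}. q_hat_off S P \<nu> \<epsilon> E E'')
      else q_hat_off S P \<nu> \<epsilon> E E')"

text \<open>Functions of \<open>\<epsilon>\<close> are regarded as functions on \<open>(0, \<infinity>)\<close>. The library's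
  \<^const>\<open>asymp_equiv\<close> would also identify functions with common zeros accumulating at \<open>0\<close>,
  which the second alternative excludes.\<close>

definition asymptotically_equivalent :: "(real \<Rightarrow> real) \<Rightarrow> (real \<Rightarrow> real) \<Rightarrow> bool" where
  "asymptotically_equivalent a b \<longleftrightarrow>
     (\<forall>\<epsilon>>0. a \<epsilon> = 0 \<and> b \<epsilon> = 0) \<or>
     (\<exists>\<epsilon>\<^sub>0>0. (\<forall>\<epsilon>\<in>{0<..<\<epsilon>\<^sub>0}. b \<epsilon> > 0) \<and> ((\<lambda>\<epsilon>. a \<epsilon> / b \<epsilon>) \<longlongrightarrow> 1) (at_right 0))"

end

theory Submission
  imports Defs
begin

text \<open>For a stationary measure \<open>\<mu>\<close> one has
  \<open>\<mu>(x) P\<^sup>x(\<tau>\<^sub>y < \<tau>\<^sub>x) = \<mu>(y) P\<^sup>y(\<tau>\<^sub>x < \<tau>\<^sub>y)\<close>. For \<open>x\<close> and \<open>y\<close> in the same essential class \<open>E\<close>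
  both probabilities converge to their unperturbed values, so \<open>\<mu>\<^sub>\<epsilon>(x) / \<mu>\<^sub>\<epsilon>(E)\<close> tends to \<open>\<nu>\<^sub>E(x)\<close>.
  For \<open>x \<in> E\<close> and \<open>y \<in> E'\<close> the target \<open>y\<close> may be replaced by all of \<open>E'\<close>, because a chain started
  in \<open>E'\<close> hits \<open>y\<close> before \<open>x\<close> with probability tending to \<open>1\<close>. Hence
  \<open>\<mu>\<^sub>\<epsilon>(E) \<nu>\<^sub>E(x) P\<^sup>x(\<tau>\<^sub>E\<^sub>' < \<tau>\<^sub>x)\<close> is asymptotically the same for all \<open>x \<in> E\<close> and equal to its
  mirror image for all \<open>y \<in> E'\<close>; averaging with the weights \<open>\<nu>\<^sub>E\<close> and \<open>\<nu>\<^sub>E\<^sub>'\<close> gives the claim.\<close>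

section \<open>Hitting one set before another\<close>

text \<open>The starting state is never tested, in line with the strictly positive times in
  \<open>return_time\<close>. For fixed \<open>n\<close> the value is a polynomial in the entries of
  \<open>P\<close>, hence continuous in \<epsilon>.\<close>

primrec hit_within ::
  "'a set \<Rightarrow> ('a \<Rightarrow> 'a \<Rightarrow> real) \<Rightarrow> 'a set \<Rightarrow> 'a set \<Rightarrow> nat \<Rightarrow> 'a \<Rightarrow> real" where
  "hit_within S P A B 0 x = 0"
| "hit_within S P A B (Suc n) x =
     (\<Sum>w\<in>S. P x w * (if w \<in> A then 1 else if w \<in> B then 0 else hit_within S P A B n w))"

text \<open>For \<open>x\<close> in \<open>S\<close> this is the limit of an increasing bounded
  sequence; for disjoint \<open>A\<close> and \<open>B\<close> it is identified below with the
  path-measure probability of returning to \<open>A\<close> before \<open>B\<close>.\<close>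

definition hit_prob ::
  "'a set \<Rightarrow> ('a \<Rightarrow> 'a \<Rightarrow> real) \<Rightarrow> 'a set \<Rightarrow> 'a set \<Rightarrow> 'a \<Rightarrow> real" where
  "hit_prob S P A B x = lim (\<lambda>n. hit_within S P A B n x)"

locale finite_chain =
  fixes S :: "'a set" and P :: "'a \<Rightarrow> 'a \<Rightarrow> real"
  assumes finite_S: "finite S" and stochastic: "stochastic_matrix S P"
begin

section \<open>Monotone limits, first-step equation and comparison of hitting probabilities\<close>

lemma P_nonneg: "x \<in> S \<Longrightarrow> y \<in> S \<Longrightarrow> 0 \<le> P x y"
  using stochastic by (auto simp: stochastic_matrix_def)

lemma P_row_sum: "x \<in> S \<Longrightarrow> (\<Sum>y\<in>S. P x y) = 1"
  using stochastic by (auto simp: stochastic_matrix_def)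

lemma hit_within_nonneg: "x \<in> S \<Longrightarrow> 0 \<le> hit_within S P A B n x"
  by (induction n arbitrary: x) (auto intro!: sum_nonneg mult_nonneg_nonneg P_nonneg)

lemma hit_within_add_le_1:
  assumes "A \<inter> B = {}" "x \<in> S"
  shows "hit_within S P A B n x + hit_within S P B A n x \<le> 1"
  using assms(2)
proof (induction n arbitrary: x)
  case (Suc n)
  have "hit_within S P A B (Suc n) x + hit_within S P B A (Suc n) x =
      (\<Sum>w\<in>S. P x w * ((if w \<in> A then 1 else if w \<in> B then 0 else hit_within S P A B n w)
        + (if w \<in> B then 1 else if w \<in> A then 0 else hit_within S P B A n w)))"
    by (simp add: sum.distrib distrib_left)
  also have "\<dots> \<le> (\<Sum>w\<in>S. P x w * 1)"
    using assms(1) Suc by (intro sum_mono mult_left_mono P_nonneg) auto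
  finally show ?case using P_row_sum[OF Suc.prems] by simp
qed auto

lemma hit_within_le_1: "x \<in> S \<Longrightarrow> hit_within S P A B n x \<le> 1"
proof (induction n arbitrary: x)
  case (Suc n)
  have "hit_within S P A B (Suc n) x \<le> (\<Sum>w\<in>S. P x w * 1)"
    unfolding hit_within.simps using Suc by (intro sum_mono mult_left_mono P_nonneg) auto
  then show ?case using P_row_sum[OF Suc.prems] by simp
qed auto

lemma hit_within_Suc: "x \<in> S \<Longrightarrow> hit_within S P A B n x \<le> hit_within S P A B (Suc n) x"
proof (induction n arbitrary: x)
  case 0
  then show ?case using hit_within_nonneg[of x A B "Suc 0"] by simp
next
  case (Suc n)
  then show ?case
    unfolding hit_within.simps(2)[of S P A B "Suc n"] hit_within.simps(2)[of S P A B n x]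
    by (intro sum_mono mult_left_mono P_nonneg) auto
qed

lemma incseq_hit_within: "x \<in> S \<Longrightarrow> incseq (\<lambda>n. hit_within S P A B n x)"
  by (intro incseq_SucI hit_within_Suc)

lemma hit_within_tendsto:
  assumes "x \<in> S"
  shows "(\<lambda>n. hit_within S P A B n x) \<longlonglongrightarrow> hit_prob S P A B x"
proof -
  have "convergent (\<lambda>n. hit_within S P A B n x)"
    by (rule Bseq_mono_convergent)
       (use incseq_hit_within[OF assms, of A B] hit_within_le_1[OF assms] hit_within_nonneg[OF assms]
         in \<open>auto simp: incseq_def intro!: BseqI[of 1]\<close>)
  then show ?thesis by (simp add: hit_prob_def convergent_LIMSEQ_iff)
qed

lemma hit_within_le_hit_prob: "x \<in> S \<Longrightarrow> hit_within S P A B n x \<le> hit_prob S P A B x"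
  by (rule incseq_le[OF incseq_hit_within hit_within_tendsto])

lemma hit_prob_nonneg: "x \<in> S \<Longrightarrow> 0 \<le> hit_prob S P A B x"
  using hit_within_le_hit_prob[of x A B 0] by simp

lemma hit_prob_add_le_1:
  assumes "A \<inter> B = {}" "x \<in> S"
  shows "hit_prob S P A B x + hit_prob S P B A x \<le> 1"
  by (rule LIMSEQ_le_const2[OF tendsto_add[OF hit_within_tendsto hit_within_tendsto]])
     (use assms hit_within_add_le_1 in auto)

lemma hit_prob_le: "x \<in> S \<Longrightarrow> (\<And>n. c * hit_within S P A B n x \<le> b) \<Longrightarrow> c * hit_prob S P A B x \<le> b"
  by (rule LIMSEQ_le_const2[OF tendsto_mult[OF tendsto_const hit_within_tendsto]]) auto

lemma hit_prob_step:
  assumes "x \<in> S"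
  shows "hit_prob S P A B x =
    (\<Sum>w\<in>S. P x w * (if w \<in> A then 1 else if w \<in> B then 0 else hit_prob S P A B w))"
proof (rule LIMSEQ_unique)
  show "(\<lambda>n. hit_within S P A B (Suc n) x) \<longlonglongrightarrow> hit_prob S P A B x"
    using hit_within_tendsto[OF assms] by (rule LIMSEQ_Suc)
  show "(\<lambda>n. hit_within S P A B (Suc n) x) \<longlonglongrightarrow>
    (\<Sum>w\<in>S. P x w * (if w \<in> A then 1 else if w \<in> B then 0 else hit_prob S P A B w))"
    unfolding hit_within.simps
    by (intro tendsto_sum tendsto_mult tendsto_const) (auto intro: hit_within_tendsto)
qed

text \<open>The maximum of the probability of never hitting \<open>A \<union> B\<close> propagates along
  transitions that avoid \<open>A \<union> B\<close>, so it cannot be positive.\<close>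

lemma hit_prob_add_eq_1:
  assumes "A \<inter> B = {}" and CS: "C \<subseteq> S"
    and closed: "\<And>z w. z \<in> C \<Longrightarrow> w \<in> S \<Longrightarrow> 0 < P z w \<Longrightarrow> w \<in> C"
    and reach: "\<And>z. z \<in> C \<Longrightarrow> \<exists>a\<in>A \<union> B. accessible S P z a"
    and "x \<in> C"
  shows "hit_prob S P A B x + hit_prob S P B A x = 1"
proof -
  \<comment> \<open>\<open>v\<close> is the probability of never entering
    \<open>A \<union> B\<close> at a positive time. In \<open>g\<close> a visit at the current time
    counts as well, so that \<open>v\<close> is \<open>P\<close> applied to
    \<open>g\<close>.\<close>
  define v where "v z = 1 - hit_prob S P A B z - hit_prob S P B A z" for z
  define g where "g w = (if w \<in> A \<union> B then 0 else v w)" for w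
  have v0: "0 \<le> v z" if "z \<in> S" for z
    using hit_prob_add_le_1[OF assms(1) that] by (simp add: v_def)
  have v_step: "v z = (\<Sum>w\<in>S. P z w * g w)" if "z \<in> S" for z
  proof -
    have "v z = (\<Sum>w\<in>S. P z w) - hit_prob S P A B z - hit_prob S P B A z"
      using P_row_sum[OF that] by (simp add: v_def)
    also have "\<dots> = (\<Sum>w\<in>S. P z w * g w)"
      unfolding hit_prob_step[OF that, of A B] hit_prob_step[OF that, of B A] sum_subtractf[symmetric]
      using assms(1) by (intro sum.cong) (auto simp: g_def v_def algebra_simps)
    finally show ?thesis .
  qed
  define M where "M = Max (v ` C)"
  have finC: "finite C" using CS finite_S finite_subset by blast
  have le_M: "v z \<le> M" if "z \<in> C" for z
    using that finC by (auto simp: M_def)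
  have "M \<in> v ` C"
    unfolding M_def using finC \<open>x \<in> C\<close> by (intro Max_in) auto
  then obtain z0 where z0: "z0 \<in> C" "v z0 = M"
    by blast
  have "M \<le> 0"
  proof (rule ccontr)
    assume "\<not> M \<le> 0"
    \<comment> \<open>\<open>M\<close> is an average of values of \<open>g\<close>, none of which
      exceeds \<open>M\<close> at a state of positive weight. So all of them equal \<open>M\<close>,
      and positivity of \<open>M\<close> excludes \<open>A \<union> B\<close>.\<close>
    have step: "w \<in> C \<and> w \<notin> A \<union> B \<and> v w = M"
      if z: "z \<in> C" "v z = M" and w: "w \<in> S" "0 < P z w" for z w
    proof -
      have zS: "z \<in> S" using z CS by auto
      have "w \<in> C" using closed z w by blast
      have nn: "0 \<le> P z u * (M - g u)" if "u \<in> S" for u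
      proof (cases "P z u = 0")
        case False
        then have "0 < P z u" using P_nonneg[OF zS that] by simp
        then have "u \<in> C" using closed z that by blast
        then show ?thesis
          using le_M[of u] \<open>\<not> M \<le> 0\<close> \<open>0 < P z u\<close> by (auto simp: g_def)
      qed simp
      have "(\<Sum>u\<in>S. P z u * (M - g u)) = M * (\<Sum>u\<in>S. P z u) - v z"
        unfolding v_step[OF zS] sum_distrib_left sum_subtractf[symmetric]
        by (intro sum.cong) (auto simp: algebra_simps)
      then have "(\<Sum>u\<in>S. P z u * (M - g u)) = 0"
        using P_row_sum[OF zS] z by simp
      then have "P z w * (M - g w) = 0"
        using sum_nonneg_eq_0_iff[OF finite_S, of "\<lambda>u. P z u * (M - g u)"] nn w by blast
      then have "g w = M" using w by simp
      then show ?thesis using \<open>\<not> M \<le> 0\<close> \<open>w \<in> C\<close> by (auto simp: g_def split: if_splits)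
    qed
    have no_path: "\<not> 0 < n_step S P n z a"
      if "a \<in> A \<union> B" "z \<in> C" "z \<notin> A \<union> B" "v z = M" for n z a
      using that
    proof (induction n arbitrary: z)
      case 0
      then show ?case by auto
    next
      case (Suc n)
      have "P z w * n_step S P n w a \<le> 0" if "w \<in> S" for w
      proof (cases "P z w = 0")
        case False
        then have pos: "0 < P z w" using P_nonneg[of z w] that Suc.prems CS by auto
        from step[OF Suc.prems(2,4) that this] have "\<not> 0 < n_step S P n w a"
          using Suc.IH Suc.prems by blast
        then show ?thesis using pos by (simp add: mult_nonneg_nonpos)
      qed simp
      then have "(\<Sum>w\<in>S. P z w * n_step S P n w a) \<le> 0"
        by (rule sum_nonpos)
      then show ?case by simp
    qed
    \<comment> \<open>\<open>z0\<close> itself may lie in \<open>A \<union> B\<close>, because the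
      start is not tested. One transition leads to a maximum point outside, to which
      \<open>no_path\<close> applies.\<close>
    have "z0 \<in> S" using z0 CS by auto
    have "\<exists>w\<in>S. 0 < P z0 w"
    proof (rule ccontr)
      assume "\<not> ?thesis"
      then have "(\<Sum>w\<in>S. P z0 w) \<le> 0" by (intro sum_nonpos) auto
      then show False using P_row_sum[OF \<open>z0 \<in> S\<close>] by simp
    qed
    then obtain w where w: "w \<in> S" "0 < P z0 w" by blast
    from step[OF z0 w] have "w \<in> C" "w \<notin> A \<union> B" "v w = M" by auto
    with reach[of w] no_path[of _ w] show False by (auto simp: accessible_def)
  qed
  moreover have "x \<in> S" using assms by auto
  ultimately have "v x = 0" using le_M[OF \<open>x \<in> C\<close>] v0[of x] by simp
  then show ?thesis by (simp add: v_def)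
qed

text \<open>The chain never leaves the closed set \<open>C\<close> and so never meets
  \<open>A\<close>; already every finite-horizon value vanishes.\<close>

lemma hit_prob_eq_0:
  assumes CS: "C \<subseteq> S"
    and closed: "\<And>z w. z \<in> C \<Longrightarrow> w \<in> S \<Longrightarrow> 0 < P z w \<Longrightarrow> w \<in> C"
    and "C \<inter> A = {}" "x \<in> C"
  shows "hit_prob S P A B x = 0"
proof -
  have "hit_within S P A B n z = 0" if "z \<in> C" for n z
    using that
  proof (induction n arbitrary: z)
    case (Suc n)
    have "P z w * (if w \<in> A then 1 else if w \<in> B then 0 else hit_within S P A B n w) = 0"
      if "w \<in> S" for w
    proof (cases "P z w = 0")
      case False
      then have "w \<in> C" using closed[OF Suc.prems that] P_nonneg[of z w] Suc.prems CS that by force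
      then show ?thesis using Suc.IH assms(3) by auto
    qed simp
    then show ?case unfolding hit_within.simps by (intro sum.neutral) blast
  qed simp
  then show ?thesis
    using hit_within_tendsto[of x A B] assms LIMSEQ_const_iff[of 0 "hit_prob S P A B x"] by auto
qed

text \<open>If the value at \<open>x\<close> were zero, zeros would propagate along all transitions
  and keep away from \<open>y\<close>, so no path from \<open>x\<close> could reach
  \<open>y\<close>.\<close>

lemma hit_prob_pos:
  assumes "x \<in> S" "y \<in> S" "x \<noteq> y" "accessible S P x y"
  shows "0 < hit_prob S P {y} {x} x"
proof (rule ccontr)
  let ?h = "hit_prob S P {y} {x}"
  assume "\<not> 0 < ?h x"
  then have hx: "?h x = 0" using hit_prob_nonneg[OF assms(1), of "{y}" "{x}"] by simp
  have step: "w \<noteq> y \<and> ?h w = 0" if z: "z \<in> S" "?h z = 0" and w: "w \<in> S" "0 < P z w" for z w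
  proof -
    have "(\<Sum>w\<in>S. P z w * (if w \<in> {y} then 1 else if w \<in> {x} then 0 else ?h w)) = 0"
      using hit_prob_step[OF z(1), of "{y}" "{x}"] z by simp
    then have "P z w * (if w \<in> {y} then 1 else if w \<in> {x} then 0 else ?h w) = 0"
      by (subst (asm) sum_nonneg_eq_0_iff)
         (use finite_S z w in \<open>auto intro!: mult_nonneg_nonneg P_nonneg hit_prob_nonneg\<close>)
    \<comment> \<open>For \<open>w = x\<close> the summand vanishes by itself and \<open>hx\<close>
      gives the claim, so paths that revisit \<open>x\<close> are covered too.\<close>
    then show ?thesis using w hx by (auto split: if_splits)
  qed
  have no_path: "\<not> 0 < n_step S P n z y" if "z \<in> S" "z \<noteq> y" "?h z = 0" for n z
    using that
  proof (induction n arbitrary: z)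
    case (Suc n)
    have "P z w * n_step S P n w y \<le> 0" if "w \<in> S" for w
    proof (cases "P z w = 0")
      case False
      then have pos: "0 < P z w" using P_nonneg[of z w] that Suc.prems by auto
      then have "\<not> 0 < n_step S P n w y"
        using Suc.IH[of w] step[of z w] Suc.prems that by blast
      then show ?thesis using pos by (simp add: mult_nonneg_nonpos)
    qed simp
    then have "(\<Sum>w\<in>S. P z w * n_step S P n w y) \<le> 0"
      by (rule sum_nonpos)
    then show ?case by simp
  qed simp
  then show False using assms hx by (auto simp: accessible_def)
qed

text \<open>Markov property at the first entry into \<open>A\<close>: from the entry point,
  \<open>y\<close> is hit before \<open>x\<close> with probability at least \<open>c\<close>. If the
  entry point is \<open>y\<close> itself, \<open>c \<le> 1\<close> is enough.\<close>

lemma hit_prob_mult_le: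
  assumes "y \<in> A" "x \<notin> A" "z \<in> S" "0 \<le> c" "c \<le> 1"
    and c: "\<And>w. w \<in> A \<Longrightarrow> w \<in> S \<Longrightarrow> c \<le> hit_prob S P {y} {x} w"
  shows "c * hit_prob S P A {x} z \<le> hit_prob S P {y} {x} z"
proof (rule hit_prob_le[OF \<open>z \<in> S\<close>])
  fix n
  show "c * hit_within S P A {x} n z \<le> hit_prob S P {y} {x} z"
    using \<open>z \<in> S\<close>
  proof (induction n arbitrary: z)
    case 0
    then show ?case by (simp add: hit_prob_nonneg)
  next
    case (Suc n)
    have "c * hit_within S P A {x} (Suc n) z =
        (\<Sum>w\<in>S. P z w * (c * (if w \<in> A then 1 else if w \<in> {x} then 0 else hit_within S P A {x} n w)))"
      by (simp add: sum_distrib_left mult.left_commute)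
    also have "\<dots> \<le> hit_prob S P {y} {x} z"
      unfolding hit_prob_step[OF Suc.prems] using assms(1,2,5) Suc c
      by (intro sum_mono mult_left_mono P_nonneg) (auto simp: hit_prob_nonneg)
    finally show ?case .
  qed
qed

lemma hit_prob_mono:
  assumes "A' \<subseteq> A" "A \<inter> B = {}" "z \<in> S"
  shows "hit_prob S P A' B z \<le> hit_prob S P A B z"
proof -
  have "hit_within S P A' B n z \<le> hit_within S P A B n z" for n
    using \<open>z \<in> S\<close>
  proof (induction n arbitrary: z)
    case (Suc n)
    then show ?case
      unfolding hit_within.simps using assms(1,2)
      by (intro sum_mono mult_left_mono P_nonneg) (auto simp: hit_within_le_1)
  qed simp
  then show ?thesis
    using LIMSEQ_le[OF hit_within_tendsto hit_within_tendsto] assms(3) by blast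
qed

text \<open>If \<open>h\<close> is the probability of hitting \<open>y\<close> before \<open>x\<close> from time \<open>0\<close> on, then \<open>P h - h\<close>
  vanishes off \<open>{x, y}\<close>, while its integral against a stationary measure is \<open>0\<close>.\<close>

lemma stationary_hit_prob_balance:
  assumes "x \<in> S" "y \<in> S" "x \<noteq> y"
    and stat: "\<And>w. w \<in> S \<Longrightarrow> (\<Sum>z\<in>S. m z * P z w) = m w"
    and rec: "hit_prob S P {y} {x} y + hit_prob S P {x} {y} y = 1"
  shows "m x * hit_prob S P {y} {x} x = m y * hit_prob S P {x} {y} y"
proof -
  let ?H = "hit_prob S P {y} {x}"
  define h where "h w = (if w = y then 1 else if w = x then 0 else ?H w)" for w
  have H: "?H z = (\<Sum>w\<in>S. P z w * h w)" if "z \<in> S" for z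
    using hit_prob_step[OF that, of "{y}" "{x}"] unfolding h_def singleton_iff .
  have "(\<Sum>z\<in>S. m z * ?H z) = (\<Sum>z\<in>S. \<Sum>w\<in>S. m z * P z w * h w)"
    by (intro sum.cong) (auto simp: H sum_distrib_left mult.assoc)
  also have "\<dots> = (\<Sum>w\<in>S. m w * h w)"
    by (subst sum.swap) (simp add: sum_distrib_right[symmetric] stat)
  finally have "(\<Sum>z\<in>S. m z * (?H z - h z)) = 0"
    by (simp add: sum_subtractf right_diff_distrib)
  moreover have "(\<Sum>z\<in>S. m z * (?H z - h z)) = (\<Sum>z\<in>{x,y}. m z * (?H z - h z))"
    using assms finite_S by (intro sum.mono_neutral_right) (auto simp: h_def)
  ultimately have "m x * ?H x + m y * (?H y - 1) = 0"
    using assms(3) by (simp add: h_def)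
  \<comment> \<open>Recurrence at \<open>y\<close> turns the defect there into the probability of
    the opposite order.\<close>
  moreover have "?H y - 1 = - hit_prob S P {x} {y} y" using rec by simp
  ultimately show ?thesis by simp
qed

section \<open>Accessibility and essential classes\<close>

lemma n_step_nonneg: "x \<in> S \<Longrightarrow> 0 \<le> n_step S P n x y"
  by (induction n arbitrary: x) (auto intro!: sum_nonneg mult_nonneg_nonneg P_nonneg)

text \<open>A single term of the Chapman-Kolmogorov sum, which suffices for concatenating
  paths.\<close>

lemma n_step_add_ge:
  assumes "x \<in> S" "z \<in> S"
  shows "n_step S P m x z * n_step S P n z y \<le> n_step S P (m + n) x y"
  using assms(1)
proof (induction m arbitrary: x)
  case 0
  then show ?case by (auto simp: n_step_nonneg)
next
  case (Suc m)
  then show ?case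
    by (auto simp: sum_distrib_right mult.assoc intro!: sum_mono mult_left_mono P_nonneg)
qed

lemma accessible_trans:
  assumes "x \<in> S" "z \<in> S" "accessible S P x z" "accessible S P z y"
  shows "accessible S P x y"
proof -
  obtain m n where "0 < n_step S P m x z" "0 < n_step S P n z y"
    using assms by (auto simp: accessible_def)
  then have "0 < n_step S P m x z * n_step S P n z y"
    by simp
  also have "\<dots> \<le> n_step S P (m + n) x y"
    by (rule n_step_add_ge[OF assms(1,2)])
  finally have "0 < n_step S P (m + n) x y" .
  then show ?thesis by (auto simp: accessible_def)
qed

lemma accessible_step:
  assumes "y \<in> S" "0 < P x y"
  shows "accessible S P x y"
  unfolding accessible_def
proof
  have "n_step S P (Suc 0) x y = P x y"
    using assms finite_S by (simp add: of_bool_def if_distrib cong: if_cong)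
  then show "0 < n_step S P (Suc 0) x y" using assms by simp
qed

text \<open>Unfolds the quotient to the image of one representative, whose self-accessibility is the
  case n = 0. Paths between two members can then be routed through it.\<close>

lemma essential_class_obtain:
  assumes "E \<in> essential_classes S P"
  obtains a where "a \<in> S" "a \<in> E" "E = {y \<in> S. accessible S P a y \<and> accessible S P y a}"
proof -
  obtain a where a: "a \<in> S" "E = {y \<in> S. accessible S P a y \<and> accessible S P y a}"
    using assms unfolding essential_classes_def communicating_classes_def quotient_def by auto
  moreover have "accessible S P a a"
    unfolding accessible_def by (rule exI[of _ 0]) simp
  ultimately show ?thesis using that by blast
qed

lemma essential_class_subset: "E \<in> essential_classes S P \<Longrightarrow> E \<subseteq> S"
  by (erule essential_class_obtain) auto

lemma essential_class_nonempty: "E \<in> essential_classes S P \<Longrightarrow> E \<noteq> {}"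
  by (erule essential_class_obtain) auto

lemma essential_class_accessible:
  "E \<in> essential_classes S P \<Longrightarrow> x \<in> E \<Longrightarrow> y \<in> E \<Longrightarrow> accessible S P x y"
  by (erule essential_class_obtain) (auto intro: accessible_trans)

lemma essential_class_closed:
  "E \<in> essential_classes S P \<Longrightarrow> z \<in> E \<Longrightarrow> w \<in> S \<Longrightarrow> 0 < P z w \<Longrightarrow> w \<in> E"
  using accessible_step by (auto simp: essential_classes_def)

text \<open>A common point would reach all of one class, and the other class is closed under
  accessibility; so each would contain the other.\<close>

lemma essential_classes_disjoint:
  assumes E: "E \<in> essential_classes S P" and E': "E' \<in> essential_classes S P" and "E \<noteq> E'"
  shows "E \<inter> E' = {}"
proof -
  have sub: "F \<subseteq> F'"
    if F: "F \<in> essential_classes S P" "F' \<in> essential_classes S P" "x \<in> F" "x \<in> F'" for F F' x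
  proof
    fix y assume y: "y \<in> F"
    then have "y \<in> S" "accessible S P x y"
      using F essential_class_subset essential_class_accessible by blast+
    then show "y \<in> F'" using F by (auto simp: essential_classes_def)
  qed
  show ?thesis using sub[OF E E'] sub[OF E' E] \<open>E \<noteq> E'\<close> by blast
qed

text \<open>Recurrence in a finite closed class: a target that meets the class is reachable from
  each of its states. This is the condition under which hitting probabilities are shown to converge
  as \<epsilon> tends to 0.\<close>

lemma essential_class_hit_prob_add_eq_1:
  assumes "E \<in> essential_classes S P" "A \<inter> B = {}" "(A \<union> B) \<inter> E \<noteq> {}" "z \<in> E"
  shows "hit_prob S P A B z + hit_prob S P B A z = 1"
proof (rule hit_prob_add_eq_1[OF assms(2) essential_class_subset[OF assms(1)]
      essential_class_closed[OF assms(1)] _ assms(4)])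
  obtain a where "a \<in> A \<union> B" "a \<in> E" using assms(3) by blast
  then show "\<exists>a\<in>A \<union> B. accessible S P x a" if "x \<in> E" for x
    using essential_class_accessible[OF assms(1) that] by blast
qed

lemma essential_class_hit_prob_eq_0:
  assumes "E \<in> essential_classes S P" "A \<inter> E = {}" "z \<in> E"
  shows "hit_prob S P A B z = 0"
proof -
  have "E \<inter> A = {}" using assms(2) by blast
  from hit_prob_eq_0[OF essential_class_subset[OF assms(1)] essential_class_closed[OF assms(1)]
      this assms(3)]
  show ?thesis .
qed

text \<open>Makes the results on essential classes available for the perturbed chains, with
  \<open>S\<close> as the class.\<close>

lemma irreducible_essential:
  assumes "irreducible_matrix S P" "S \<noteq> {}"
  shows "S \<in> essential_classes S P"
proof -
  let ?R = "{(x, y). x \<in> S \<and> y \<in> S \<and> accessible S P x y \<and> accessible S P y x}"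
  obtain a where a: "a \<in> S" using assms(2) by blast
  have "?R `` {a} = S"
    using a assms(1) unfolding irreducible_matrix_def by blast
  then have "S \<in> communicating_classes S P"
    unfolding communicating_classes_def using quotientI[OF a, of ?R] by simp
  then show ?thesis by (simp add: essential_classes_def)
qed

section \<open>Stationary distributions on an essential class\<close>

context
  fixes E m
  assumes E: "E \<in> essential_classes S P" and stat: "stationary_distribution E P m"
begin

text \<open>Extended by zero, \<open>m\<close> is invariant under the whole chain on
  \<open>S\<close>, since no mass leaves the closed class. The general balance equation then
  applies.\<close>

lemma essential_class_balance:
  assumes "x \<in> E" "y \<in> E" "x \<noteq> y"
  shows "m x * hit_prob S P {y} {x} x = m y * hit_prob S P {x} {y} y"
proof -
  define m' where "m' z = (if z \<in> E then m z else 0)" for z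
  have ES: "E \<subseteq> S" using E by (rule essential_class_subset)
  have "(\<Sum>z\<in>S. m' z * P z w) = m' w" if "w \<in> S" for w
  proof -
    have eq: "(\<Sum>z\<in>S. m' z * P z w) = (\<Sum>z\<in>E. m z * P z w)"
      using ES finite_S by (intro sum.mono_neutral_cong_right) (auto simp: m'_def)
    show ?thesis
    proof (cases "w \<in> E")
      case True
      then show ?thesis using eq stat by (simp add: m'_def stationary_distribution_def)
    next
      case False
      have "P z w = 0" if "z \<in> E" for z
      proof -
        have "\<not> 0 < P z w" using essential_class_closed[OF E that \<open>w \<in> S\<close>] False by blast
        moreover have "0 \<le> P z w" using ES that \<open>w \<in> S\<close> by (intro P_nonneg) auto
        ultimately show ?thesis by simp
      qed
      then show ?thesis using eq False by (simp add: m'_def)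
    qed
  qed
  then have "m' x * hit_prob S P {y} {x} x = m' y * hit_prob S P {x} {y} y"
    using assms ES by (intro stationary_hit_prob_balance essential_class_hit_prob_add_eq_1[OF E]) auto
  then show ?thesis using assms by (simp add: m'_def)
qed

lemma essential_class_hit_prob_pos:
  "x \<in> E \<Longrightarrow> y \<in> E \<Longrightarrow> x \<noteq> y \<Longrightarrow> 0 < hit_prob S P {y} {x} x"
  by (rule hit_prob_pos) (use essential_class_subset[OF E] essential_class_accessible[OF E] in auto)

text \<open>By balance and positivity of the hitting probabilities, one zero of \<open>m\<close>
  would spread to all of \<open>E\<close>, against total mass 1.\<close>

lemma essential_class_stationary_pos:
  assumes "x \<in> E"
  shows "0 < m x"
proof (rule ccontr)
  assume "\<not> 0 < m x"
  then have "m x = 0" using stat assms by (auto simp: stationary_distribution_def order.order_iff_strict)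
  have "m y = 0" if "y \<in> E" for y
  proof (cases "x = y")
    case False
    then show ?thesis
      using \<open>m x = 0\<close> essential_class_balance[OF assms that]
        essential_class_hit_prob_pos[OF that assms] by simp
  qed (use \<open>m x = 0\<close> in simp)
  then show False using stat by (simp add: stationary_distribution_def)
qed

end

end

section \<open>The path measure of hitting events\<close>

text \<open>A word lists the states from time 1 on; the state \<open>x\<close> at time 0 is kept
  apart because return times ignore it.\<close>

primrec path_weight :: "('a \<Rightarrow> 'a \<Rightarrow> real) \<Rightarrow> 'a \<Rightarrow> 'a list \<Rightarrow> real" where
  "path_weight P x [] = 1"
| "path_weight P x (w # l) = P x w * path_weight P w l"

primrec path_hits :: "'a set \<Rightarrow> 'a set \<Rightarrow> 'a list \<Rightarrow> bool" where
  "path_hits A B [] \<longleftrightarrow> False"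
| "path_hits A B (w # l) \<longleftrightarrow> w \<in> A \<or> w \<notin> B \<and> path_hits A B l"

abbreviation words :: "'a set \<Rightarrow> nat \<Rightarrow> 'a list set" where
  "words S n \<equiv> {l. set l \<subseteq> S \<and> length l = n}"

lemma path_weight_eq_prod:
  "path_weight P x l = (\<Prod>i<length l. P ((x # l) ! i) ((x # l) ! Suc i))"
proof (induction l arbitrary: x)
  case (Cons w l)
  show ?case
    by (simp add: Cons.IH[of w] prod.lessThan_Suc_shift del: prod.lessThan_Suc)
qed simp

text \<open>The recursion tests \<open>A\<close> before \<open>B\<close> at each position.
  Disjointness makes this agree with excluding \<open>B\<close> up to and including the position
  \<open>k\<close>.\<close>

lemma path_hits_iff:
  assumes "A \<inter> B = {}"
  shows "path_hits A B l \<longleftrightarrow> (\<exists>k<length l. l ! k \<in> A \<and> (\<forall>j\<le>k. l ! j \<notin> B))"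
proof (induction l)
  case (Cons w l)
  have "(\<exists>k<length (w # l). (w # l) ! k \<in> A \<and> (\<forall>j\<le>k. (w # l) ! j \<notin> B)) \<longleftrightarrow>
      w \<in> A \<and> w \<notin> B \<or> (\<exists>k<length l. l ! k \<in> A \<and> (\<forall>j\<le>Suc k. (w # l) ! j \<notin> B))"
    unfolding length_Cons Ex_less_Suc2 by simp
  also have "\<dots> \<longleftrightarrow> w \<in> A \<or> w \<notin> B \<and> (\<exists>k<length l. l ! k \<in> A \<and> (\<forall>j\<le>k. l ! j \<notin> B))"
    using assms unfolding less_Suc_eq_le[symmetric] All_less_Suc2 by auto
  finally show ?case using Cons.IH by simp
qed simp

lemma path_hits_append: "path_hits A B l \<Longrightarrow> path_hits A B (l @ l')"
  by (induction l) auto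

lemma sum_words_Suc: "(\<Sum>l\<in>words S (Suc n). f l) = (\<Sum>w\<in>S. \<Sum>l\<in>words S n. f (w # l))"
proof -
  have words: "words S (Suc n) = (\<lambda>(w, l). w # l) ` (S \<times> words S n)"
    by (auto simp: length_Suc_conv image_iff)
  have inj: "inj_on (\<lambda>(w, l). w # l) (S \<times> words S n)"
    by (auto simp: inj_on_def)
  show ?thesis
    unfolding words sum.reindex[OF inj] sum.cartesian_product by (simp add: o_def case_prod_beta)
qed

context finite_chain
begin

lemma sum_path_weight: "x \<in> S \<Longrightarrow> (\<Sum>l\<in>words S n. path_weight P x l) = 1"
proof (induction n arbitrary: x)
  case (Suc n)
  then show ?case
    by (simp add: sum_words_Suc sum_distrib_left[symmetric] P_row_sum)
qed (simp add: Collect_conv_if cong: conj_cong)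

text \<open>Splitting words at the first letter reproduces the first-step recursion. Once that
  letter lies in \<open>A\<close> the tail is free, and its weights sum to 1.\<close>

lemma hit_within_eq_sum:
  "x \<in> S \<Longrightarrow> hit_within S P A B n x = (\<Sum>l\<in>words S n. path_weight P x l * of_bool (path_hits A B l))"
proof (induction n arbitrary: x)
  case (Suc n)
  have "(\<Sum>l\<in>words S n. path_weight P x (w # l) * of_bool (path_hits A B (w # l))) =
      P x w * (if w \<in> A then 1 else if w \<in> B then 0 else hit_within S P A B n w)" if "w \<in> S" for w
  proof -
    have "(\<Sum>l\<in>words S n. path_weight P x (w # l) * of_bool (path_hits A B (w # l))) =
        P x w * (\<Sum>l\<in>words S n. path_weight P w l * of_bool (w \<in> A \<or> w \<notin> B \<and> path_hits A B l))"
      unfolding sum_distrib_left by (intro sum.cong) auto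
    then show ?thesis
      by (cases "w \<in> A"; cases "w \<in> B") (simp_all add: Suc.IH[OF that] sum_path_weight[OF that])
  qed
  then show ?case
    unfolding sum_words_Suc hit_within.simps by (intro sum.cong) auto
qed (simp add: Collect_conv_if cong: conj_cong)

section \<open>From the path measure to hitting probabilities\<close>

context
  fixes x assumes x: "x \<in> S"
begin

interpretation prob_space "path_measure S P x"
  by (rule prob_space_path_measure[OF finite_S stochastic x])

lemmas space_pm = space_path_measure[OF finite_S stochastic x]

lemma cylinder_eq:
  assumes "length l = Suc n"
  shows "{\<omega> \<in> UNIV \<rightarrow>\<^sub>E S. map \<omega> [0..<Suc n] = l} = {\<omega> \<in> UNIV \<rightarrow>\<^sub>E S. \<forall>i\<le>n. \<omega> i = l ! i}"
proof -
  have "map \<omega> [0..<Suc n] = l \<longleftrightarrow> (\<forall>i\<le>n. \<omega> i = l ! i)" for \<omega>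
    using assms by (auto simp: list_eq_iff_nth_eq less_Suc_eq_le simp del: upt_Suc)
  then show ?thesis by simp
qed

lemma cylinder_sets:
  assumes "length l = Suc n"
  shows "{\<omega> \<in> UNIV \<rightarrow>\<^sub>E S. map \<omega> [0..<Suc n] = l} \<in> events"
proof -
  have "{\<omega> \<in> space (PiM UNIV (\<lambda>_::nat. count_space S)). \<forall>i\<in>{..n}. \<omega> i = l ! i}
      \<in> sets (PiM UNIV (\<lambda>_. count_space S))"
    by measurable
  then show ?thesis
    unfolding cylinder_eq[OF assms] sets_path_measure[OF finite_S stochastic x]
      space_PiM space_count_space Ball_def atMost_iff .
qed

text \<open>Cylinders also fix time 0, whereas \<open>Q\<close> sees only times 1 to n; hence words
  of length n + 1 and \<open>tl\<close>.\<close>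

lemma path_property_eq_UN:
  "{\<omega> \<in> space (path_measure S P x). Q (map \<omega> [1..<Suc n])} =
    (\<Union>l\<in>{l \<in> words S (Suc n). Q (tl l)}. {\<omega> \<in> UNIV \<rightarrow>\<^sub>E S. map \<omega> [0..<Suc n] = l})"
proof -
  have "tl (map \<omega> [0..<Suc n]) = map \<omega> [1..<Suc n]" for \<omega> :: "nat \<Rightarrow> 'a"
    by (simp add: upt_conv_Cons del: upt_Suc)
  moreover have "map \<omega> [0..<Suc n] \<in> words S (Suc n)" if "\<omega> \<in> UNIV \<rightarrow>\<^sub>E S" for \<omega>
    using that by (auto simp: PiE_iff)
  ultimately show ?thesis
    unfolding space_pm by auto
qed

lemma finite_words: "finite (words S n)"
  by (rule finite_lists_length_eq[OF finite_S])

lemma path_property_sets: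
  "{\<omega> \<in> space (path_measure S P x). Q (map \<omega> [1..<Suc n])} \<in> events"
  unfolding path_property_eq_UN
proof (rule sets.finite_UN)
  show "finite {l \<in> words S (Suc n). Q (tl l)}"
    by (rule finite_subset[OF _ finite_words]) auto
qed (rule cylinder_sets, simp)

lemma measure_path_property:
  "prob {\<omega> \<in> space (path_measure S P x). Q (map \<omega> [1..<Suc n])} =
    (\<Sum>l\<in>words S n. path_weight P x l * of_bool (Q l))"
proof -
  let ?C = "\<lambda>l. {\<omega> \<in> UNIV \<rightarrow>\<^sub>E S. map \<omega> [0..<Suc n] = l}"
  let ?L = "{l \<in> words S (Suc n). Q (tl l)}"
  have fin: "finite ?L"
    by (rule finite_subset[OF _ finite_words]) auto
  have "prob (\<Union>l\<in>?L. ?C l) = (\<Sum>l\<in>?L. prob (?C l))"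
  proof (rule finite_measure_finite_Union[OF fin])
    show "?C ` ?L \<subseteq> events" using cylinder_sets by blast
    show "disjoint_family_on ?C ?L" unfolding disjoint_family_on_def by blast
  qed
  also have "\<dots> = (\<Sum>l\<in>words S (Suc n). of_bool (Q (tl l)) * prob (?C l))"
    by (intro sum.mono_neutral_cong_left finite_words) auto
  also have "\<dots> = (\<Sum>c\<in>S. \<Sum>l\<in>words S n. of_bool (Q l) * prob (?C (c # l)))"
    by (simp only: sum_words_Suc list.sel)
  also have "\<dots> = (\<Sum>c\<in>S. \<Sum>l\<in>words S n. of_bool (Q l) * (of_bool (c = x) * path_weight P c l))"
  proof (intro sum.cong arg_cong2[where f="(*)"] refl)
    fix c l assume c: "c \<in> S" and l: "l \<in> words S n"
    have mem: "(c # l) ! i \<in> S" if "i \<le> n" for i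
    proof -
      have "(c # l) ! i \<in> set (c # l)" using l that by (intro nth_mem) auto
      then show ?thesis using c l by auto
    qed
    have len: "length (c # l) = Suc n" using l by simp
    show "prob (?C (c # l)) = of_bool (c = x) * path_weight P c l"
      unfolding cylinder_eq[OF len] path_weight_eq_prod
      using path_measure_cylinder[OF finite_S stochastic x, of n "\<lambda>i. (c # l) ! i"] mem l by simp
  qed
  \<comment> \<open>The point mass at time 0 leaves only the initial letter
    \<open>x\<close>.\<close>
  also have "\<dots> = (\<Sum>c\<in>S. if c = x then (\<Sum>l\<in>words S n. path_weight P c l * of_bool (Q l)) else 0)"
    by (intro sum.cong) (auto simp: mult.commute)
  also have "\<dots> = (\<Sum>l\<in>words S n. path_weight P x l * of_bool (Q l))"
    using x finite_S by (subst sum.delta) auto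
  finally show ?thesis unfolding path_property_eq_UN .
qed

lemma return_time_less_iff:
  assumes "A \<inter> B = {}"
  shows "return_time A \<omega> < return_time B \<omega> \<longleftrightarrow> (\<exists>n. path_hits A B (map \<omega> [1..<Suc n]))"
proof -
  have hits: "path_hits A B (map \<omega> [1..<Suc n]) \<longleftrightarrow>
      (\<exists>k<n. \<omega> (Suc k) \<in> A \<and> (\<forall>j\<le>k. \<omega> (Suc j) \<notin> B))" for n
    unfolding path_hits_iff[OF assms] by (intro ex_cong1 conj_cong) (auto simp del: upt_Suc)
  \<comment> \<open>Any visit to \<open>A\<close> before the first visit to \<open>B\<close> is a
    witness; it need not be the first one.\<close>
  have "return_time A \<omega> < return_time B \<omega> \<longleftrightarrow>
      (\<exists>m. 0 < m \<and> \<omega> m \<in> A \<and> enat m < return_time B \<omega>)"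
    unfolding return_time_def[of A] Inf_less_iff by auto
  also have "\<dots> \<longleftrightarrow> (\<exists>k. \<omega> (Suc k) \<in> A \<and> enat (Suc k) < return_time B \<omega>)"
    by (auto simp: gr0_conv_Suc)
  also have "\<dots> \<longleftrightarrow> (\<exists>k. \<omega> (Suc k) \<in> A \<and> (\<forall>j\<le>k. \<omega> (Suc j) \<notin> B))"
  proof -
    have "enat (Suc k) < return_time B \<omega> \<longleftrightarrow> (\<forall>j\<le>k. \<omega> (Suc j) \<notin> B)" if "\<omega> (Suc k) \<in> A" for k
    proof -
      \<comment> \<open>The strict bound becomes a weak one at the successor, so that
        \<open>le_Inf_iff\<close> applies, also when \<open>B\<close> is never visited.\<close>
      have "enat (Suc k) < return_time B \<omega> \<longleftrightarrow> enat (Suc (Suc k)) \<le> return_time B \<omega>"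
        by (simp add: Suc_ile_eq)
      also have "\<dots> \<longleftrightarrow> (\<forall>m. 0 < m \<and> \<omega> m \<in> B \<longrightarrow> Suc (Suc k) \<le> m)"
        unfolding return_time_def le_Inf_iff by auto
      also have "\<dots> \<longleftrightarrow> (\<forall>j. \<omega> (Suc j) \<in> B \<longrightarrow> Suc k \<le> j)"
        by (auto simp: gr0_conv_Suc)
      finally show ?thesis by (auto simp: not_le[symmetric] not_less_eq_eq)
    qed
    then show ?thesis by auto
  qed
  finally show ?thesis unfolding hits by blast
qed

text \<open>The events of a hit within n steps increase to the event in question, so continuity from
  below applies. This is the bridge by which \<open>q_hat_off\<close> becomes a sum of values of
  \<open>hit_prob\<close>.\<close>

lemma measure_return_time_less:
  assumes "A \<inter> B = {}"
  shows "prob {\<omega> \<in> space (path_measure S P x). return_time A \<omega> < return_time B \<omega>} =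
    hit_prob S P A B x"
proof -
  let ?E = "\<lambda>n. {\<omega> \<in> space (path_measure S P x). path_hits A B (map \<omega> [1..<Suc n])}"
  have "incseq ?E"
  proof (intro incseq_SucI subsetI)
    fix n \<omega> assume "\<omega> \<in> ?E n"
    then have "\<omega> \<in> space (path_measure S P x)"
      "path_hits A B (map \<omega> [1..<Suc n] @ [\<omega> (Suc n)])"
      by (blast intro: path_hits_append)+
    moreover have "map \<omega> [1..<Suc (Suc n)] = map \<omega> [1..<Suc n] @ [\<omega> (Suc n)]"
      by simp
    ultimately show "\<omega> \<in> ?E (Suc n)" by (simp only: mem_Collect_eq)
  qed
  then have "(\<lambda>n. prob (?E n)) \<longlonglongrightarrow> prob (\<Union>n. ?E n)"
    using path_property_sets by (intro finite_Lim_measure_incseq image_subsetI)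
  then have "(\<lambda>n. hit_within S P A B n x) \<longlonglongrightarrow> prob (\<Union>n. ?E n)"
    unfolding measure_path_property hit_within_eq_sum[OF x] .
  moreover have "(\<Union>n. ?E n) = {\<omega> \<in> space (path_measure S P x). return_time A \<omega> < return_time B \<omega>}"
    unfolding return_time_less_iff[OF assms] by blast
  ultimately show ?thesis
    using LIMSEQ_unique[OF hit_within_tendsto[OF x]] by simp
qed

end

end

section \<open>Limits as the perturbation vanishes\<close>

text \<open>Identities for the perturbed chain hold only at positive \<epsilon>, so they enter
  limits in this form.\<close>

lemma tendsto_at_right_0_cong:
  fixes f g :: "real \<Rightarrow> real"
  assumes "(f \<longlongrightarrow> c) (at_right 0)" "\<And>\<epsilon>. 0 < \<epsilon> \<Longrightarrow> f \<epsilon> = g \<epsilon>" "c = d"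
  shows "(g \<longlongrightarrow> d) (at_right 0)"
proof (rule Lim_transform_eventually)
  show "\<forall>\<^sub>F \<epsilon> in at_right 0. f \<epsilon> = g \<epsilon>"
    using eventually_at_right_less[of "0::real"] assms(2) by (rule eventually_mono)
qed (use assms(1,3) in simp)

locale perturbed_chain =
  fixes S :: "'a set" and P :: "real \<Rightarrow> 'a \<Rightarrow> 'a \<Rightarrow> real" and \<mu> :: "real \<Rightarrow> 'a \<Rightarrow> real"
    and \<nu> :: "'a set \<Rightarrow> 'a \<Rightarrow> real"
  assumes perturbed: "irreducibly_perturbed_markov_chain S P"
    and mu_stat: "\<And>\<epsilon>. \<epsilon> > 0 \<Longrightarrow> stationary_distribution S (P \<epsilon>) (\<mu> \<epsilon>)"
    and nu_stat: "\<And>E. E \<in> essential_classes S (P 0) \<Longrightarrow> stationary_distribution E (P 0) (\<nu> E)"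
begin

lemma chain: "0 \<le> \<epsilon> \<Longrightarrow> finite_chain S (P \<epsilon>)"
  using perturbed
  by (auto simp: irreducibly_perturbed_markov_chain_def perturbed_markov_chain_def finite_chain_def)

sublocale unperturbed: finite_chain S "P 0"
  by (rule chain) simp

lemma P_tendsto: "x \<in> S \<Longrightarrow> y \<in> S \<Longrightarrow> ((\<lambda>\<epsilon>. P \<epsilon> x y) \<longlongrightarrow> P 0 x y) (at_right 0)"
  using perturbed by (auto simp: irreducibly_perturbed_markov_chain_def perturbed_markov_chain_def)

lemma essential_perturbed:
  assumes "\<epsilon> > 0" "x \<in> S"
  shows "S \<in> essential_classes S (P \<epsilon>)"
  using perturbed assms finite_chain.irreducible_essential[OF chain[of \<epsilon>]]
  by (auto simp: irreducibly_perturbed_markov_chain_def)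

lemma mu_pos: "\<epsilon> > 0 \<Longrightarrow> x \<in> S \<Longrightarrow> 0 < \<mu> \<epsilon> x"
  using finite_chain.essential_class_stationary_pos[OF chain essential_perturbed mu_stat] by simp

lemma mu_balance:
  "\<epsilon> > 0 \<Longrightarrow> x \<in> S \<Longrightarrow> y \<in> S \<Longrightarrow> x \<noteq> y \<Longrightarrow>
    \<mu> \<epsilon> x * hit_prob S (P \<epsilon>) {y} {x} x = \<mu> \<epsilon> y * hit_prob S (P \<epsilon>) {x} {y} y"
  using finite_chain.essential_class_balance[OF chain essential_perturbed mu_stat] by simp

lemma hit_prob_perturbed_pos:
  assumes "\<epsilon> > 0" "x \<in> S" "y \<in> S" "x \<noteq> y"
  shows "0 < hit_prob S (P \<epsilon>) {y} {x} x"
  using finite_chain.essential_class_hit_prob_pos[OF chain essential_perturbed[OF assms(1,2)]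
      mu_stat[OF assms(1)] assms(2-4)] assms(1) by simp

section \<open>Convergence of hitting probabilities\<close>

lemma hit_within_tendsto_0:
  "x \<in> S \<Longrightarrow> ((\<lambda>\<epsilon>. hit_within S (P \<epsilon>) A B n x) \<longlongrightarrow> hit_within S (P 0) A B n x) (at_right 0)"
proof (induction n arbitrary: x)
  case (Suc n)
  then show ?case
    unfolding hit_within.simps by (intro tendsto_sum tendsto_mult P_tendsto) auto
qed simp

text \<open>Limits of increasing sequences of continuous functions are lower semicontinuous; two such
  functions with sum at most \<open>1\<close>, and equal to \<open>1\<close> in the limit, must both converge.\<close>

lemma hit_prob_eventually_greater:
  assumes "x \<in> S" "a < hit_prob S (P 0) A B x"
  shows "\<forall>\<^sub>F \<epsilon> in at_right 0. a < hit_prob S (P \<epsilon>) A B x"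
proof -
  obtain n where n: "a < hit_within S (P 0) A B n x"
    using order_tendstoD(1)[OF unperturbed.hit_within_tendsto[OF assms(1)] assms(2)]
    by (auto simp: eventually_sequentially)
  from order_tendstoD(1)[OF hit_within_tendsto_0[OF assms(1)] this]
    eventually_at_right_less[of "0::real"]
  show ?thesis
  proof eventually_elim
    case (elim \<epsilon>)
    then show ?case
      using finite_chain.hit_within_le_hit_prob[OF chain[of \<epsilon>] assms(1), of A B n] by simp
  qed
qed

lemma hit_prob_tendsto:
  assumes "x \<in> S" "A \<inter> B = {}"
    and sum1: "hit_prob S (P 0) A B x + hit_prob S (P 0) B A x = 1"
  shows "((\<lambda>\<epsilon>. hit_prob S (P \<epsilon>) A B x) \<longlongrightarrow> hit_prob S (P 0) A B x) (at_right 0)"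
proof (rule order_tendstoI)
  fix a assume "a < hit_prob S (P 0) A B x"
  then show "\<forall>\<^sub>F \<epsilon> in at_right 0. a < hit_prob S (P \<epsilon>) A B x"
    by (rule hit_prob_eventually_greater[OF assms(1)])
next
  fix a assume "hit_prob S (P 0) A B x < a"
  then have "1 - a < hit_prob S (P 0) B A x" using sum1 by simp
  from hit_prob_eventually_greater[OF assms(1) this] eventually_at_right_less[of "0::real"]
  show "\<forall>\<^sub>F \<epsilon> in at_right 0. hit_prob S (P \<epsilon>) A B x < a"
  proof eventually_elim
    case (elim \<epsilon>)
    then show ?case
      using finite_chain.hit_prob_add_le_1[OF chain[of \<epsilon>] assms(2,1)] by simp
  qed
qed

lemma hit_prob_tendsto_essential:
  assumes "E \<in> essential_classes S (P 0)" "A \<inter> B = {}" "(A \<union> B) \<inter> E \<noteq> {}" "x \<in> E"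
  shows "((\<lambda>\<epsilon>. hit_prob S (P \<epsilon>) A B x) \<longlongrightarrow> hit_prob S (P 0) A B x) (at_right 0)"
  using subsetD[OF unperturbed.essential_class_subset[OF assms(1)] assms(4)] assms(2)
    unperturbed.essential_class_hit_prob_add_eq_1[OF assms]
  by (rule hit_prob_tendsto)

section \<open>Asymptotic ratios of stationary masses and hitting probabilities\<close>

text \<open>Balance expresses both ratios by hitting probabilities, on \<open>S\<close> for the
  perturbed chain and on \<open>E\<close> for the unperturbed one. These converge, and the limit of
  the denominator is positive.\<close>

lemma mu_ratio_tendsto:
  assumes E: "E \<in> essential_classes S (P 0)" and "x \<in> E" "y \<in> E"
  shows "((\<lambda>\<epsilon>. \<mu> \<epsilon> y / \<mu> \<epsilon> x) \<longlongrightarrow> \<nu> E y / \<nu> E x) (at_right 0)"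
proof -
  note ES = unperturbed.essential_class_subset[OF E]
  have pos: "0 < \<nu> E x"
    by (rule unperturbed.essential_class_stationary_pos[OF E nu_stat[OF E] \<open>x \<in> E\<close>])
  show ?thesis
  proof (cases "x = y")
    case True
    show ?thesis
    proof (rule tendsto_at_right_0_cong[OF tendsto_const[of "1::real"]])
      show "1 = \<mu> \<epsilon> y / \<mu> \<epsilon> x" if "0 < \<epsilon>" for \<epsilon>
        using mu_pos[OF that subsetD[OF ES \<open>x \<in> E\<close>]] True by simp
      show "1 = \<nu> E y / \<nu> E x" using pos True by simp
    qed
  next
    case False
    have xy: "x \<in> S" "y \<in> S" using assms ES by auto
    have pos': "0 < hit_prob S (P 0) {x} {y} y"
      using unperturbed.essential_class_hit_prob_pos[OF E nu_stat[OF E] assms(3,2)] False by simp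
    show ?thesis
    proof (rule tendsto_at_right_0_cong)
      show "((\<lambda>\<epsilon>. hit_prob S (P \<epsilon>) {y} {x} x / hit_prob S (P \<epsilon>) {x} {y} y) \<longlongrightarrow>
          hit_prob S (P 0) {y} {x} x / hit_prob S (P 0) {x} {y} y) (at_right 0)"
        by (intro tendsto_divide hit_prob_tendsto_essential[OF E]) (use assms False pos' in auto)
      show "hit_prob S (P 0) {y} {x} x / hit_prob S (P 0) {x} {y} y = \<nu> E y / \<nu> E x"
        using unperturbed.essential_class_balance[OF E nu_stat[OF E] assms(2,3) False] pos pos'
        by (simp add: field_simps)
      show "hit_prob S (P \<epsilon>) {y} {x} x / hit_prob S (P \<epsilon>) {x} {y} y = \<mu> \<epsilon> y / \<mu> \<epsilon> x"
        if "0 < \<epsilon>" for \<epsilon>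
        using mu_balance[OF that xy False] mu_pos[OF that xy(1)]
          hit_prob_perturbed_pos[OF that xy(2,1)] False by (simp add: field_simps)
    qed
  qed
qed

text \<open>Summation of the pointwise ratios over \<open>E\<close>, where \<open>\<nu> E\<close>
  has total mass 1.\<close>

lemma mu_class_ratio_tendsto:
  assumes E: "E \<in> essential_classes S (P 0)" and "x \<in> E"
  shows "((\<lambda>\<epsilon>. sum (\<mu> \<epsilon>) E * \<nu> E x / \<mu> \<epsilon> x) \<longlongrightarrow> 1) (at_right 0)"
proof -
  have "((\<lambda>\<epsilon>. (\<Sum>y\<in>E. \<mu> \<epsilon> y / \<mu> \<epsilon> x) * \<nu> E x) \<longlongrightarrow> (\<Sum>y\<in>E. \<nu> E y / \<nu> E x) * \<nu> E x) (at_right 0)"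
    by (intro tendsto_intros mu_ratio_tendsto assms)
  moreover have "(\<Sum>y\<in>E. \<nu> E y / \<nu> E x) * \<nu> E x = 1"
    using nu_stat[OF E] unperturbed.essential_class_stationary_pos[OF E nu_stat[OF E] \<open>x \<in> E\<close>]
    by (simp add: stationary_distribution_def flip: sum_divide_distrib)
  ultimately show ?thesis by (simp flip: sum_divide_distrib)
qed

lemma class_disjoint:
  "E \<in> essential_classes S (P 0) \<Longrightarrow> E' \<in> essential_classes S (P 0) \<Longrightarrow> E \<noteq> E' \<Longrightarrow> x \<in> E \<Longrightarrow> x \<notin> E'"
  using unperturbed.essential_classes_disjoint by blast

text \<open>Monotonicity bounds the ratio above by 1; the Markov property at the entry into
  \<open>E'\<close> bounds it below by a quantity tending to 1.\<close>

lemma hit_class_ratio_tendsto: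
  assumes E: "E \<in> essential_classes S (P 0)" and E': "E' \<in> essential_classes S (P 0)"
    and "E \<noteq> E'" "x \<in> E" "y \<in> E'"
  shows "((\<lambda>\<epsilon>. hit_prob S (P \<epsilon>) {y} {x} x / hit_prob S (P \<epsilon>) E' {x} x) \<longlongrightarrow> 1) (at_right 0)"
proof (rule tendsto_sandwich)
  \<comment> \<open>The worst entry point: the least probability, over starts in \<open>E'\<close>,
    of hitting \<open>y\<close> before \<open>x\<close>. Finiteness of \<open>E'\<close> lets the
    pointwise limits pass to the minimum.\<close>
  define c where "c \<epsilon> = Min ((\<lambda>w. hit_prob S (P \<epsilon>) {y} {x} w) ` E')" for \<epsilon>
  have xE': "x \<notin> E'" by (rule class_disjoint[OF assms(1-4)])
  then have "x \<noteq> y" using assms by auto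
  have E'S: "E' \<subseteq> S" by (rule unperturbed.essential_class_subset[OF E'])
  have ES: "x \<in> S" "y \<in> S"
    using unperturbed.essential_class_subset[OF E] E'S assms by auto
  have fin: "finite E'" by (rule finite_subset[OF E'S unperturbed.finite_S])
  have c_le: "c \<epsilon> \<le> hit_prob S (P \<epsilon>) {y} {x} w" if "w \<in> E'" for \<epsilon> w
    unfolding c_def using fin that by (intro Min_le) auto
  \<comment> \<open>The unperturbed chain stays in \<open>E'\<close>, so it never meets
    \<open>x\<close> and hits \<open>y\<close> almost surely.\<close>
  have lim: "((\<lambda>\<epsilon>. hit_prob S (P \<epsilon>) {y} {x} w) \<longlongrightarrow> 1) (at_right 0)" if "w \<in> E'" for w
  proof -
    have "hit_prob S (P 0) {x} {y} w = 0"
      by (rule unperturbed.essential_class_hit_prob_eq_0[OF E' _ that]) (use xE' in auto)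
    moreover have "hit_prob S (P 0) {y} {x} w + hit_prob S (P 0) {x} {y} w = 1"
      by (rule unperturbed.essential_class_hit_prob_add_eq_1[OF E' _ _ that])
         (use \<open>x \<noteq> y\<close> \<open>y \<in> E'\<close> in auto)
    moreover have "((\<lambda>\<epsilon>. hit_prob S (P \<epsilon>) {y} {x} w) \<longlongrightarrow> hit_prob S (P 0) {y} {x} w) (at_right 0)"
      by (rule hit_prob_tendsto_essential[OF E' _ _ that]) (use \<open>x \<noteq> y\<close> \<open>y \<in> E'\<close> in auto)
    ultimately show ?thesis by simp
  qed
  show "(c \<longlongrightarrow> 1) (at_right 0)"
  proof (rule order_tendstoI)
    fix a :: real assume "a < 1"
    then have "\<forall>\<^sub>F \<epsilon> in at_right 0. \<forall>w\<in>E'. a < hit_prob S (P \<epsilon>) {y} {x} w"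
      by (intro eventually_ball_finite fin ballI order_tendstoD(1)[OF lim])
    then show "\<forall>\<^sub>F \<epsilon> in at_right 0. a < c \<epsilon>"
    proof (rule eventually_mono)
      show "a < c \<epsilon>" if "\<forall>w\<in>E'. a < hit_prob S (P \<epsilon>) {y} {x} w" for \<epsilon>
        unfolding c_def using fin \<open>y \<in> E'\<close> that by (subst Min_gr_iff) auto
    qed
  next
    fix a :: real assume "1 < a"
    have "\<forall>\<^sub>F \<epsilon> in at_right 0. hit_prob S (P \<epsilon>) {y} {x} y < a"
      using order_tendstoD(2)[OF lim[OF \<open>y \<in> E'\<close>] \<open>1 < a\<close>] .
    then show "\<forall>\<^sub>F \<epsilon> in at_right 0. c \<epsilon> < a"
      by (rule eventually_mono) (use c_le[OF \<open>y \<in> E'\<close>] in \<open>rule le_less_trans\<close>)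
  qed
  have both: "c \<epsilon> * hit_prob S (P \<epsilon>) E' {x} x \<le> hit_prob S (P \<epsilon>) {y} {x} x \<and>
     hit_prob S (P \<epsilon>) {y} {x} x \<le> hit_prob S (P \<epsilon>) E' {x} x \<and> 0 < hit_prob S (P \<epsilon>) E' {x} x"
    if "0 < \<epsilon>" for \<epsilon>
  proof -
    interpret e: finite_chain S "P \<epsilon>" using that by (intro chain) simp
    have "c \<epsilon> \<le> hit_prob S (P \<epsilon>) {y} {x} y" by (rule c_le[OF \<open>y \<in> E'\<close>])
    also have "\<dots> \<le> 1"
      using e.hit_prob_add_le_1[of "{y}" "{x}" y, OF _ ES(2)]
        e.hit_prob_nonneg[OF ES(2), of "{x}" "{y}"] \<open>x \<noteq> y\<close> by simp
    finally have "c \<epsilon> \<le> 1" .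
    moreover have "0 \<le> c \<epsilon>"
      unfolding c_def using fin \<open>y \<in> E'\<close> subsetD[OF E'S] e.hit_prob_nonneg
      by (subst Min_ge_iff) auto
    ultimately have "c \<epsilon> * hit_prob S (P \<epsilon>) E' {x} x \<le> hit_prob S (P \<epsilon>) {y} {x} x"
      using c_le by (intro e.hit_prob_mult_le[OF \<open>y \<in> E'\<close> xE' ES(1)])
    moreover have "hit_prob S (P \<epsilon>) {y} {x} x \<le> hit_prob S (P \<epsilon>) E' {x} x"
      by (rule e.hit_prob_mono[OF _ _ ES(1)]) (use \<open>y \<in> E'\<close> xE' in auto)
    moreover have "0 < hit_prob S (P \<epsilon>) {y} {x} x"
      by (rule hit_prob_perturbed_pos[OF that ES \<open>x \<noteq> y\<close>])
    ultimately show ?thesis by simp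
  qed
  show "\<forall>\<^sub>F \<epsilon> in at_right 0. c \<epsilon> \<le> hit_prob S (P \<epsilon>) {y} {x} x / hit_prob S (P \<epsilon>) E' {x} x"
    using eventually_at_right_less[of "0::real"]
    by (rule eventually_mono) (use both in \<open>simp add: pos_le_divide_eq\<close>)
  show "\<forall>\<^sub>F \<epsilon> in at_right 0. hit_prob S (P \<epsilon>) {y} {x} x / hit_prob S (P \<epsilon>) E' {x} x \<le> 1"
    using eventually_at_right_less[of "0::real"]
    by (rule eventually_mono) (use both in \<open>simp add: pos_divide_le_eq\<close>)
qed auto

lemma q_hat_off_eq:
  assumes "E \<in> essential_classes S (P 0)" "E' \<in> essential_classes S (P 0)" "E \<noteq> E'" "0 \<le> \<epsilon>"
  shows "q_hat_off S P \<nu> \<epsilon> E E' = (\<Sum>x\<in>E. (\<nu> E x)\<^sup>2 * hit_prob S (P \<epsilon>) E' {x} x)"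
  unfolding q_hat_off_def
proof (intro sum.cong arg_cong2[where f="(*)"] refl)
  fix x assume "x \<in> E"
  then have "x \<in> S" "E' \<inter> {x} = {}"
    using class_disjoint[OF assms(1-3)] unperturbed.essential_class_subset[OF assms(1)] by auto
  then show "measure (path_measure S (P \<epsilon>) x)
      {\<omega> \<in> space (path_measure S (P \<epsilon>) x). return_time E' \<omega> < return_time {x} \<omega>} =
      hit_prob S (P \<epsilon>) E' {x} x"
    by (rule finite_chain.measure_return_time_less[OF chain[OF assms(4)]])
qed

text \<open>The unperturbed chain cannot leave \<open>E\<close>, so each hitting probability in the
  sum tends to 0.\<close>

lemma q_hat_off_tendsto_0:
  assumes E: "E \<in> essential_classes S (P 0)" and E': "E' \<in> essential_classes S (P 0)" and "E \<noteq> E'"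
  shows "((\<lambda>\<epsilon>. q_hat_off S P \<nu> \<epsilon> E E') \<longlongrightarrow> 0) (at_right 0)"
proof -
  have "((\<lambda>\<epsilon>. hit_prob S (P \<epsilon>) E' {x} x) \<longlongrightarrow> 0) (at_right 0)" if "x \<in> E" for x
  proof -
    have "E' \<inter> {x} = {}" using class_disjoint[OF assms that] by simp
    moreover have "E' \<inter> E = {}"
      using unperturbed.essential_classes_disjoint[OF assms] by (simp add: Int_commute)
    ultimately show ?thesis
      using hit_prob_tendsto_essential[OF E, of E' "{x}" x]
        unperturbed.essential_class_hit_prob_eq_0[OF E _ that, of E' "{x}"] that by simp
  qed
  then have "((\<lambda>\<epsilon>. \<Sum>x\<in>E. (\<nu> E x)\<^sup>2 * hit_prob S (P \<epsilon>) E' {x} x) \<longlongrightarrow> (\<Sum>x\<in>E. (\<nu> E x)\<^sup>2 * 0)) (at_right 0)"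
    by (intro tendsto_sum tendsto_mult tendsto_const)
  then show ?thesis
    by (rule tendsto_at_right_0_cong) (simp_all add: q_hat_off_eq[OF assms])
qed

text \<open>Serves the case of equal classes, where the equivalence requires eventual positivity of
  the diagonal entry.\<close>

lemma q_hat_diag_tendsto_1:
  assumes "E \<in> essential_classes S (P 0)"
  shows "((\<lambda>\<epsilon>. q_hat S P \<nu> \<epsilon> E E) \<longlongrightarrow> 1) (at_right 0)"
proof -
  have "((\<lambda>\<epsilon>. 1 - (\<Sum>E''\<in>essential_classes S (P 0) - {E}. q_hat_off S P \<nu> \<epsilon> E E'')) \<longlongrightarrow>
      1 - (\<Sum>E''\<in>essential_classes S (P 0) - {E}. 0)) (at_right 0)"
    using assms by (intro tendsto_diff tendsto_sum tendsto_const q_hat_off_tendsto_0) auto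
  then show ?thesis by (simp add: q_hat_def)
qed

lemma mu_class_pos:
  assumes "E \<in> essential_classes S (P 0)" "0 < \<epsilon>"
  shows "0 < sum (\<mu> \<epsilon>) E"
proof (rule sum_pos)
  show "finite E"
    by (rule finite_subset[OF unperturbed.essential_class_subset[OF assms(1)] unperturbed.finite_S])
  show "E \<noteq> {}" by (rule unperturbed.essential_class_nonempty[OF assms(1)])
  show "0 < \<mu> \<epsilon> x" if "x \<in> E" for x
    using mu_pos[OF assms(2)] unperturbed.essential_class_subset[OF assms(1)] that by blast
qed

section \<open>Flows between two classes and detailed balance\<close>

text \<open>Since \<open>sum (\<mu> \<epsilon>) E * \<nu> E x\<close> is asymptotic to
  \<open>\<mu> \<epsilon> x\<close>, this approximates the stationary rate of excursions from
  \<open>x\<close> that reach \<open>E'\<close> before returning. Only one of the two factors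
  \<open>\<nu> E x\<close> of \<open>q_hat\<close> is absorbed; the other is kept as an averaging
  weight.\<close>

definition flow :: "real \<Rightarrow> 'a set \<Rightarrow> 'a set \<Rightarrow> 'a \<Rightarrow> real" where
  "flow \<epsilon> E E' x = sum (\<mu> \<epsilon>) E * \<nu> E x * hit_prob S (P \<epsilon>) E' {x} x"

lemma flow_pos:
  assumes E: "E \<in> essential_classes S (P 0)" and E': "E' \<in> essential_classes S (P 0)"
    and "E \<noteq> E'" "x \<in> E" "0 < \<epsilon>"
  shows "0 < flow \<epsilon> E E' x"
proof -
  interpret e: finite_chain S "P \<epsilon>" using \<open>0 < \<epsilon>\<close> by (intro chain) simp
  obtain y where y: "y \<in> E'" using unperturbed.essential_class_nonempty[OF E'] by auto
  have xE': "x \<notin> E'" by (rule class_disjoint[OF assms(1-4)])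
  have S: "x \<in> S" "y \<in> S"
    using assms(4) y unperturbed.essential_class_subset[OF E] unperturbed.essential_class_subset[OF E']
    by auto
  have "0 < hit_prob S (P \<epsilon>) {y} {x} x"
    using hit_prob_perturbed_pos[OF \<open>0 < \<epsilon>\<close> S] y xE' by auto
  also have "\<dots> \<le> hit_prob S (P \<epsilon>) E' {x} x"
    using y xE' S by (intro e.hit_prob_mono) auto
  finally show ?thesis
    unfolding flow_def
    by (intro mult_pos_pos mu_class_pos[OF E \<open>0 < \<epsilon>\<close>]
        unperturbed.essential_class_stationary_pos[OF E nu_stat[OF E] \<open>x \<in> E\<close>])
qed

lemma flow_ratio_tendsto:
  assumes E: "E \<in> essential_classes S (P 0)" and E': "E' \<in> essential_classes S (P 0)"
    and "E \<noteq> E'" "x \<in> E" "y \<in> E'"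
  shows "((\<lambda>\<epsilon>. flow \<epsilon> E E' x / flow \<epsilon> E' E y) \<longlongrightarrow> 1) (at_right 0)"
proof -
  have S: "x \<in> S" "y \<in> S"
    using assms(4,5) unperturbed.essential_class_subset[OF E] unperturbed.essential_class_subset[OF E']
    by auto
  have "x \<noteq> y" using class_disjoint[OF assms(1-4)] assms(5) by auto
  show ?thesis
  proof (rule tendsto_at_right_0_cong)
    \<comment> \<open>All four factors tend to 1: class masses are compared with point masses, and
      hitting a class with hitting a point.\<close>
    show "((\<lambda>\<epsilon>. (sum (\<mu> \<epsilon>) E * \<nu> E x / \<mu> \<epsilon> x) / (sum (\<mu> \<epsilon>) E' * \<nu> E' y / \<mu> \<epsilon> y)
        * ((hit_prob S (P \<epsilon>) {x} {y} y / hit_prob S (P \<epsilon>) E {y} y)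
         / (hit_prob S (P \<epsilon>) {y} {x} x / hit_prob S (P \<epsilon>) E' {x} x))) \<longlongrightarrow> 1 / 1 * (1 / 1)) (at_right 0)"
      by (intro tendsto_mult tendsto_divide one_neq_zero
          mu_class_ratio_tendsto[OF E assms(4)] mu_class_ratio_tendsto[OF E' assms(5)]
          hit_class_ratio_tendsto[OF assms] hit_class_ratio_tendsto[OF E' E assms(3)[symmetric] assms(5,4)])
    fix \<epsilon> :: real assume "0 < \<epsilon>"
    \<comment> \<open>The hypothesis \<open>m * h = m' * h'\<close> is the balance between
      \<open>x\<close> and \<open>y\<close>; it removes all point quantities exactly for each
      positive \<epsilon>.\<close>
    have cancel: "(M * n / m) / (M' * n' / m') * ((h' / H') / (h / H)) = (M * n * H) / (M' * n' * H')"
      if "m * h = m' * h'" "0 < m" "0 < m'" "0 < h" "0 < h'" for M n m M' n' m' h' H' h H :: real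
    proof -
      have "(M * n / m) / (M' * n' / m') * ((h' / H') / (h / H)) =
          (M * n * H) / (M' * n' * H') * ((m' * h') / (m * h))"
        by (simp add: mult_ac)
      then show ?thesis using that by simp
    qed
    show "(sum (\<mu> \<epsilon>) E * \<nu> E x / \<mu> \<epsilon> x) / (sum (\<mu> \<epsilon>) E' * \<nu> E' y / \<mu> \<epsilon> y)
        * ((hit_prob S (P \<epsilon>) {x} {y} y / hit_prob S (P \<epsilon>) E {y} y)
         / (hit_prob S (P \<epsilon>) {y} {x} x / hit_prob S (P \<epsilon>) E' {x} x))
        = flow \<epsilon> E E' x / flow \<epsilon> E' E y"
      unfolding flow_def
      by (intro cancel mu_balance mu_pos hit_prob_perturbed_pos S \<open>0 < \<epsilon>\<close> \<open>x \<noteq> y\<close> \<open>x \<noteq> y\<close>[symmetric])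
  qed simp
qed

text \<open>Here the square in \<open>q_hat\<close> is split: one factor \<open>\<nu> E x\<close>
  belongs to the flow, the other makes the sum an average of flows.\<close>

lemma class_flow_eq:
  assumes "E \<in> essential_classes S (P 0)" "E' \<in> essential_classes S (P 0)" "E \<noteq> E'" "0 < \<epsilon>"
  shows "sum (\<mu> \<epsilon>) E * q_hat S P \<nu> \<epsilon> E E' = (\<Sum>x\<in>E. \<nu> E x * flow \<epsilon> E E' x)"
proof -
  have "q_hat S P \<nu> \<epsilon> E E' = (\<Sum>x\<in>E. (\<nu> E x)\<^sup>2 * hit_prob S (P \<epsilon>) E' {x} x)"
    using q_hat_off_eq[OF assms(1-3)] assms(3,4) by (simp add: q_hat_def)
  then show ?thesis
    unfolding flow_def by (simp only: sum_distrib_left) (simp add: power2_eq_square mult_ac)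
qed

text \<open>An average with the weights \<open>\<nu> E x\<close>, of total mass 1, of ratios that
  all tend to 1.\<close>

lemma class_flow_ratio_tendsto:
  assumes E: "E \<in> essential_classes S (P 0)" and E': "E' \<in> essential_classes S (P 0)"
    and "E \<noteq> E'" "y \<in> E'"
  shows "((\<lambda>\<epsilon>. sum (\<mu> \<epsilon>) E * q_hat S P \<nu> \<epsilon> E E' / flow \<epsilon> E' E y) \<longlongrightarrow> 1) (at_right 0)"
proof -
  have "((\<lambda>\<epsilon>. \<Sum>x\<in>E. \<nu> E x * (flow \<epsilon> E E' x / flow \<epsilon> E' E y)) \<longlongrightarrow> (\<Sum>x\<in>E. \<nu> E x * 1)) (at_right 0)"
    by (intro tendsto_sum tendsto_mult tendsto_const flow_ratio_tendsto assms)
  then show ?thesis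
  proof (rule tendsto_at_right_0_cong)
    show "(\<Sum>x\<in>E. \<nu> E x * 1) = 1"
      using nu_stat[OF E] by (simp add: stationary_distribution_def)
    show "(\<Sum>x\<in>E. \<nu> E x * (flow \<epsilon> E E' x / flow \<epsilon> E' E y)) =
        sum (\<mu> \<epsilon>) E * q_hat S P \<nu> \<epsilon> E E' / flow \<epsilon> E' E y" if "0 < \<epsilon>" for \<epsilon>
      unfolding class_flow_eq[OF assms(1-3) that] by (simp add: sum_divide_distrib)
  qed
qed

lemma asymptotic_detailed_balance:
  assumes E: "E \<in> essential_classes S (P 0)" and E': "E' \<in> essential_classes S (P 0)"
  shows "asymptotically_equivalent
    (\<lambda>\<epsilon>. sum (\<mu> \<epsilon>) E * q_hat S P \<nu> \<epsilon> E E') (\<lambda>\<epsilon>. sum (\<mu> \<epsilon>) E' * q_hat S P \<nu> \<epsilon> E' E)"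
proof (cases "E = E'")
  case True
  \<comment> \<open>The two sides are the same function, so only its positivity near 0 is at stake;
    it makes the quotient equal to 1.\<close>
  have "\<forall>\<^sub>F \<epsilon> in at_right 0. 0 < q_hat S P \<nu> \<epsilon> E E"
    using order_tendstoD(1)[OF q_hat_diag_tendsto_1[OF E], of 0] by simp
  then obtain b where b: "0 < b" "\<And>\<epsilon>. 0 < \<epsilon> \<Longrightarrow> \<epsilon> < b \<Longrightarrow> 0 < q_hat S P \<nu> \<epsilon> E E"
    by (auto simp: eventually_at_right_field)
  then have pos: "0 < sum (\<mu> \<epsilon>) E * q_hat S P \<nu> \<epsilon> E E" if "\<epsilon> \<in> {0<..<b}" for \<epsilon>
    using that mu_class_pos[OF E] by (intro mult_pos_pos) auto
  have "\<forall>\<^sub>F \<epsilon> in at_right 0. 0 < sum (\<mu> \<epsilon>) E * q_hat S P \<nu> \<epsilon> E E"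
    unfolding eventually_at_right_field using b(1) pos by auto
  then have "\<forall>\<^sub>F \<epsilon> in at_right 0.
      sum (\<mu> \<epsilon>) E * q_hat S P \<nu> \<epsilon> E E / (sum (\<mu> \<epsilon>) E * q_hat S P \<nu> \<epsilon> E E) = 1"
    by (rule eventually_mono) (rule divide_self, rule less_imp_neq[symmetric])
  then show ?thesis
    unfolding asymptotically_equivalent_def True[symmetric] using pos b(1)
    by (intro disjI2 exI[of _ b] conjI ballI tendsto_eventually)
next
  case False
  obtain x where x: "x \<in> E" using unperturbed.essential_class_nonempty[OF E] by auto
  obtain y where y: "y \<in> E'" using unperturbed.essential_class_nonempty[OF E'] by auto
  have pos: "0 < sum (\<mu> \<epsilon>) E' * q_hat S P \<nu> \<epsilon> E' E" if "0 < \<epsilon>" for \<epsilon>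
    unfolding class_flow_eq[OF E' E False[symmetric] that]
  proof (rule sum_pos)
    show "finite E'"
      by (rule finite_subset[OF unperturbed.essential_class_subset[OF E'] unperturbed.finite_S])
    show "E' \<noteq> {}" using y by auto
    show "0 < \<nu> E' z * flow \<epsilon> E' E z" if "z \<in> E'" for z
      using \<open>0 < \<epsilon>\<close> that False
      by (intro mult_pos_pos flow_pos[OF E' E]
          unperturbed.essential_class_stationary_pos[OF E' nu_stat[OF E']]) auto
  qed
  have "((\<lambda>\<epsilon>. (sum (\<mu> \<epsilon>) E * q_hat S P \<nu> \<epsilon> E E') / (sum (\<mu> \<epsilon>) E' * q_hat S P \<nu> \<epsilon> E' E))
      \<longlongrightarrow> 1) (at_right 0)"
  proof (rule tendsto_at_right_0_cong)
    \<comment> \<open>The flows at the chosen points serve as references: each side is compared with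
      a flow in the opposite direction, and the two flows with each other.\<close>
    show "((\<lambda>\<epsilon>. (sum (\<mu> \<epsilon>) E * q_hat S P \<nu> \<epsilon> E E' / flow \<epsilon> E' E y)
        / ((sum (\<mu> \<epsilon>) E' * q_hat S P \<nu> \<epsilon> E' E / flow \<epsilon> E E' x)
           * (flow \<epsilon> E E' x / flow \<epsilon> E' E y))) \<longlongrightarrow> 1 / (1 * 1)) (at_right 0)"
      by (intro tendsto_mult tendsto_divide class_flow_ratio_tendsto flow_ratio_tendsto
          E E' False False[symmetric] x y) simp
    show "(sum (\<mu> \<epsilon>) E * q_hat S P \<nu> \<epsilon> E E' / flow \<epsilon> E' E y)
        / ((sum (\<mu> \<epsilon>) E' * q_hat S P \<nu> \<epsilon> E' E / flow \<epsilon> E E' x)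
           * (flow \<epsilon> E E' x / flow \<epsilon> E' E y)) =
        (sum (\<mu> \<epsilon>) E * q_hat S P \<nu> \<epsilon> E E') / (sum (\<mu> \<epsilon>) E' * q_hat S P \<nu> \<epsilon> E' E)" if "0 < \<epsilon>" for \<epsilon>
      using flow_pos[OF E E' False x that] flow_pos[OF E' E False[symmetric] y that] by simp
  qed simp
  then show ?thesis
    unfolding asymptotically_equivalent_def using pos
    by (intro disjI2 exI[of _ 1] conjI ballI) simp_all
qed

end

theorem proposition4p1:
  fixes S :: "'a set"
    and P :: "real \<Rightarrow> 'a \<Rightarrow> 'a \<Rightarrow> real"
    and \<mu> :: "real \<Rightarrow> 'a \<Rightarrow> real"
    and \<nu> :: "'a set \<Rightarrow> 'a \<Rightarrow> real"
  assumes "irreducibly_perturbed_markov_chain S P"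
    and "\<And>\<epsilon>. \<epsilon> > 0 \<Longrightarrow> stationary_distribution S (P \<epsilon>) (\<mu> \<epsilon>)"
    and "\<And>E. E \<in> essential_classes S (P 0) \<Longrightarrow> stationary_distribution E (P 0) (\<nu> E)"
    and "E \<in> essential_classes S (P 0)"
    and "E' \<in> essential_classes S (P 0)"
  shows "asymptotically_equivalent
           (\<lambda>\<epsilon>. (\<Sum>x\<in>E. \<mu> \<epsilon> x) * q_hat S P \<nu> \<epsilon> E E')
           (\<lambda>\<epsilon>. (\<Sum>x\<in>E'. \<mu> \<epsilon> x) * q_hat S P \<nu> \<epsilon> E' E)"
proof -
  interpret perturbed_chain S P \<mu> \<nu>
    by (rule perturbed_chain.intro) (fact assms)+
  show ?thesis by (rule asymptotic_detailed_balance) (fact assms)+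
qed

end
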